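(* Let $C\subset\mathbb R^n$ be closed and convex, and let $f:\mathbb R^n\to\mathbb R$ be essentially smooth. Let $x^1\in C$ be such that $\{x\in C: f(x)\le f(x^1)\}$ is bounded. Suppose the standard model $\phi^\sharp(y,x)=f(x)+f^\circ(x,y-x)$ is used in the bundle trust-region algorithm described in the context, started at $x^1$. Let the trial points $z^k\in C$ satisfying the trial-step condition in step 4 be drawn at random and independently according to a continuous probability distribution on $C$. Then with probability one the steps of the algorithm are identical with the steps of the classical trust-region algorithm. Moreover, if $\phi^\sharp$ is strict, then every accumulation point of the sequence $x^j$ of serious iterates is a critical point of the program $\min\{f(x):x\in C\}$.
   Context: **Notation.** $f^\circ(x,d)$ is the Clarke directional derivative, $\partial f(x)$ the Clarke subdifferential, $N_C(x)$ the normal cone to $C$ at $x$. $x\in C$ is a critical point of $\min\{f(x):x\in C\}$ if $0\in\partial f(x)+N_C(x)$. $f$ is essentially smooth if it is locally Lipschitz and strictly differentiable almost everywhere. $\|\cdot\|$ is an arbitrary fixed norm on $\mathbb R^n$, $B(x,R)$ its closed ball. "Continuous" distribution is understood as giving probability zero to Lebesgue null sets. **Strictness.** $\phi=\phi^\sharp$ is strict if for every $x$: whenever $y_k\to x$, $x_k\to x$, there exist $\epsilon_k\to0^+$ with $f(y_k)\le\phi(y_k,x_k)+\epsilon_k\|y_k-x_k\|$. **Cutting planes and working models for $\phi^\sharp$.** A cutting plane at serious iterate $x$ for trial step $z$ is $f(x)+g_z^\top(\cdot-x)$, where $g_z\in\partial f(x)$ satisfies $f^\circ(x,z-x)=g_z^\top(z-x)$;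 for $z=x$ any $g\in\partial f(x)$ is allowed (exactness plane). A working model $\phi_k(\cdot,x)$ is the maximum of a set $\mathcal G_k$ of cutting planes at serious iterate $x$ which contains at least one exactness plane. **Algorithm.** Parameters $0<\gamma<\widetilde\gamma<1$, $0<\gamma<\Gamma\le1$, $0<\theta<1$, $M\ge1$. 1. Choose $x^1\in C$, $R_1^\sharp>0$, put $j=1$. 2. Stop if $x^j$ is a critical point. Otherwise go to the inner loop. 3. Put $k=1$, $R_1=R_j^\sharp$ and build an initial working model $\phi_1(\cdot,x^j)$ from a set $\mathcal G_1$ of cutting planes containing an exactness plane at $x^j$. 4. Find a solution $y^k$ of: minimize $\phi_k(y,x^j)$ subject to $y\in C$, $\|y-x^j\|\le R_k$. Choose a trial step $z^k\in C\cap B(x^j,M\|x^j-y^k\|)$ satisfying the trial-step condition $f(x^j)-\phi_k(z^k,x^j)\ge\theta\big(f(x^j)-\phi_k(y^k,x^j)\big)$. 5. If $\rho_k=\dfrac{f(x^j)-f(z^k)}{f(x^j)-\phi_k(z^k,x^j)}\ge\gamma$, put $x^{j+1}=z^k$ (serious step) and go to 8. Otherwise (null step) continue with 6. 6. Form $\mathcal G_{k+1}$ from $\mathcal G_k$ by adding a cutting plane at $z^k$ (possibly further ones), possibly removing some older inactive planes (those not attaining the maximum in $\phi_k$ at the current trial step) but keeping an exactness plane; build $\phi_{k+1}$. 7. Compute $\widetilde\rho_k=\dfrac{f(x^j)-\phi^\sharp(z^k,x^j)}{f(x^j)-\phi_k(z^k,x^j)}$; put $R_{k+1}=R_k$ if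 $\widetilde\rho_k<\widetilde\gamma$, $R_{k+1}=\frac12R_k$ if $\widetilde\rho_k\ge\widetilde\gamma$. Increase $k$ and go back to 4. 8. Put $R_{j+1}^\sharp=R_k$ if $\rho_k<\Gamma$, $R_{j+1}^\sharp=2R_k$ if $\rho_k\ge\Gamma$. Increase $j$ and go back to 2. **Classical trust-region algorithm.** The same scheme with the first-order Taylor polynomial $f(x^j)+\nabla f(x^j)^\top(\cdot-x^j)$ as the only plane (so $\phi_k(\cdot,x^j)$ equals it for all $k$), and where in step 7 the radius is halved after every null step.
   Formalization: Identity of all steps with the classical algorithm is stated when f is strictly differentiable at x^1; for other x^1 (where the gradient may not exist, e.g. f(x)=max(x,2x), x^1=0) it is stated for all steps from the second serious iterate on. *)

theory Defs
  imports "HOL-Probability.Probability"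
begin

definition is_norm :: "('a::real_vector \<Rightarrow> real) \<Rightarrow> bool" where
  "is_norm N \<longleftrightarrow>
     (\<forall>x. N x = 0 \<longleftrightarrow> x = 0) \<and>
     (\<forall>x y. N (x + y) \<le> N x + N y) \<and>
     (\<forall>c x. N (c *\<^sub>R x) = \<bar>c\<bar> * N x)"

(* Only meaningful for locally Lipschitz f, where the limes superior is finite. *)
definition clarke_dd :: "('a::euclidean_space \<Rightarrow> real) \<Rightarrow> 'a \<Rightarrow> 'a \<Rightarrow> real" where
  "clarke_dd f x d =
     real_of_ereal (Limsup (nhds x \<times>\<^sub>F at_right (0::real))
       (\<lambda>(y, t). ereal ((f (y + t *\<^sub>R d) - f y) / t)))"

definition clarke_subdiff :: "('a::euclidean_space \<Rightarrow> real) \<Rightarrow> 'a \<Rightarrow> 'a set" where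
  "clarke_subdiff f x = {g. \<forall>d. g \<bullet> d \<le> clarke_dd f x d}"

definition normal_cone :: "'a::euclidean_space set \<Rightarrow> 'a \<Rightarrow> 'a set" where
  "normal_cone C x = {v. \<forall>y\<in>C. v \<bullet> (y - x) \<le> 0}"

definition critical_point :: "('a::euclidean_space \<Rightarrow> real) \<Rightarrow> 'a set \<Rightarrow> 'a \<Rightarrow> bool" where
  "critical_point f C x \<longleftrightarrow>
     x \<in> C \<and> (\<exists>g \<in> clarke_subdiff f x. \<exists>v \<in> normal_cone C x. g + v = 0)"

definition locally_lipschitz :: "('a::metric_space \<Rightarrow> real) \<Rightarrow> bool" where
  "locally_lipschitz f \<longleftrightarrow> (\<forall>x. \<exists>e>0. \<exists>L. L-lipschitz_on (ball x e) f)"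

(* The quotient is 0 on the diagonal u = v, so the diagonal imposes no condition. *)
definition strictly_differentiable :: "('a::euclidean_space \<Rightarrow> real) \<Rightarrow> 'a \<Rightarrow> bool" where
  "strictly_differentiable f x \<longleftrightarrow>
     (\<exists>g. ((\<lambda>(u, v). (f u - f v - g \<bullet> (u - v)) / norm (u - v)) \<longlongrightarrow> 0)
            (nhds x \<times>\<^sub>F nhds x))"

definition essentially_smooth :: "('a::euclidean_space \<Rightarrow> real) \<Rightarrow> bool" where
  "essentially_smooth f \<longleftrightarrow>
     locally_lipschitz f \<and> (AE x in lborel. strictly_differentiable f x)"

definition standard_model :: "('a::euclidean_space \<Rightarrow> real) \<Rightarrow> 'a \<Rightarrow> 'a \<Rightarrow> real" where
  "standard_model f y x = f x + clarke_dd f x (y - x)"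

definition strict_model ::
  "('a::euclidean_space \<Rightarrow> real) \<Rightarrow> ('a \<Rightarrow> real) \<Rightarrow> ('a \<Rightarrow> 'a \<Rightarrow> real) \<Rightarrow> bool" where
  "strict_model N f \<phi> \<longleftrightarrow>
     (\<forall>x ys xs. ys \<longlonglongrightarrow> x \<and> xs \<longlonglongrightarrow> x \<longrightarrow>
        (\<exists>e::nat \<Rightarrow> real. (\<forall>k. 0 < e k) \<and> e \<longlonglongrightarrow> 0 \<and>
           (\<forall>k. f (ys k) \<le> \<phi> (ys k) (xs k) + e k * N (ys k - xs k))))"

definition affine_plane :: "('a::euclidean_space \<Rightarrow> real) \<Rightarrow> 'a \<Rightarrow> 'a \<Rightarrow> 'a \<Rightarrow> real" where
  "affine_plane f x g = (\<lambda>y. f x + g \<bullet> (y - x))"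

(* m is a cutting plane at serious iterate x for trial step z.  For z = x the equation
   holds for every subgradient g, which gives the exactness planes. *)
definition cutting_plane ::
  "('a::euclidean_space \<Rightarrow> real) \<Rightarrow> 'a \<Rightarrow> 'a \<Rightarrow> ('a \<Rightarrow> real) \<Rightarrow> bool" where
  "cutting_plane f x z m \<longleftrightarrow>
     (\<exists>g \<in> clarke_subdiff f x. clarke_dd f x (z - x) = g \<bullet> (z - x) \<and> m = affine_plane f x g)"

(* The set G need not be finite, but its pointwise maximum has to be attained. *)
definition working_model ::
  "('a::euclidean_space \<Rightarrow> real) \<Rightarrow> 'a \<Rightarrow> ('a \<Rightarrow> real) set \<Rightarrow> ('a \<Rightarrow> real) \<Rightarrow> bool" where
  "working_model f x G \<phi> \<longleftrightarrow>
     (\<forall>m\<in>G. \<exists>z. cutting_plane f x z m) \<and> (\<exists>m\<in>G. cutting_plane f x x m) \<and>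
     (\<forall>y. (\<exists>m\<in>G. \<phi> y = m y) \<and> (\<forall>m\<in>G. m y \<le> \<phi> y))"

definition update_of_planes ::
  "('a::euclidean_space \<Rightarrow> real) \<Rightarrow> 'a \<Rightarrow> 'a \<Rightarrow> ('a \<Rightarrow> real) \<Rightarrow>
   ('a \<Rightarrow> real) set \<Rightarrow> ('a \<Rightarrow> real) set \<Rightarrow> bool" where
  "update_of_planes f x z \<phi> G G' \<longleftrightarrow>
     (\<exists>m\<in>G'. cutting_plane f x z m) \<and>
     (\<forall>m \<in> G - G'. m z \<noteq> \<phi> z) \<and>
     (\<exists>m \<in> G \<inter> G'. cutting_plane f x x m)"

(* Record of everything a trust-region algorithm produces.  The outer counter j and the
   inner counter k start at 0.  Entries at indices which are never reached are irrelevant. *)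
record 'a tr_run =
  iterate :: "nat \<Rightarrow> 'a"
  memory_radius :: "nat \<Rightarrow> real"
  radius :: "nat \<Rightarrow> nat \<Rightarrow> real"
  planes :: "nat \<Rightarrow> nat \<Rightarrow> ('a \<Rightarrow> real) set"
  model :: "nat \<Rightarrow> nat \<Rightarrow> 'a \<Rightarrow> real"
  model_min :: "nat \<Rightarrow> nat \<Rightarrow> 'a"
  trial :: "nat \<Rightarrow> nat \<Rightarrow> 'a"

definition rho :: "('a::euclidean_space \<Rightarrow> real) \<Rightarrow> 'a tr_run \<Rightarrow> nat \<Rightarrow> nat \<Rightarrow> real" where
  "rho f r j k =
     (f (iterate r j) - f (trial r j k)) /
     (f (iterate r j) - model r j k (trial r j k))"

definition rho_tilde :: "('a::euclidean_space \<Rightarrow> real) \<Rightarrow> 'a tr_run \<Rightarrow> nat \<Rightarrow> nat \<Rightarrow> real" where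
  "rho_tilde f r j k =
     (f (iterate r j) - standard_model f (trial r j k) (iterate r j)) /
     (f (iterate r j) - model r j k (trial r j k))"

(* Control flow: reached r j says that the j-th serious iterate is produced, and
   executed r j k that trial step k of the inner loop at this iterate is carried out. *)
inductive
  reached :: "('a::euclidean_space \<Rightarrow> real) \<Rightarrow> 'a set \<Rightarrow> real \<Rightarrow> 'a tr_run \<Rightarrow> nat \<Rightarrow> bool" and
  executed :: "('a \<Rightarrow> real) \<Rightarrow> 'a set \<Rightarrow> real \<Rightarrow> 'a tr_run \<Rightarrow> nat \<Rightarrow> nat \<Rightarrow> bool"
  for f :: "'a \<Rightarrow> real" and C :: "'a set" and \<gamma> :: real and r :: "'a tr_run"
where
  start: "reached f C \<gamma> r 0"
| enter: "reached f C \<gamma> r j \<Longrightarrow> \<not> critical_point f C (iterate r j) \<Longrightarrow> executed f C \<gamma> r j 0"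
| serious: "executed f C \<gamma> r j k \<Longrightarrow> rho f r j k \<ge> \<gamma> \<Longrightarrow> reached f C \<gamma> r (Suc j)"
| null: "executed f C \<gamma> r j k \<Longrightarrow> \<not> rho f r j k \<ge> \<gamma> \<Longrightarrow> executed f C \<gamma> r j (Suc k)"

(* The part of a step common to both algorithms; halve is the condition for halving the
   radius after a null step. *)
definition tr_step ::
  "('a::euclidean_space \<Rightarrow> real) \<Rightarrow> 'a set \<Rightarrow> ('a \<Rightarrow> real) \<Rightarrow> real \<Rightarrow> real \<Rightarrow> real \<Rightarrow> real \<Rightarrow>
   bool \<Rightarrow> 'a tr_run \<Rightarrow> nat \<Rightarrow> nat \<Rightarrow> bool" where
  "tr_step f C N \<gamma> \<Gamma> \<theta> M halve r j k \<longleftrightarrow>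
     (let x = iterate r j; R = radius r j k; \<phi> = model r j k;
          y = model_min r j k; z = trial r j k in
        (k = 0 \<longrightarrow> R = memory_radius r j) \<and>
        is_arg_min \<phi> (\<lambda>u. u \<in> C \<and> N (u - x) \<le> R) y \<and>
        z \<in> C \<and> N (z - x) \<le> M * N (x - y) \<and>
        f x - \<phi> z \<ge> \<theta> * (f x - \<phi> y) \<and>
        (if rho f r j k \<ge> \<gamma>
         then iterate r (Suc j) = z \<and>
              memory_radius r (Suc j) = (if rho f r j k < \<Gamma> then R else 2 * R)
         else radius r j (Suc k) = (if halve then R / 2 else R)))"

definition bundle_step ::
  "('a::euclidean_space \<Rightarrow> real) \<Rightarrow> 'a set \<Rightarrow> ('a \<Rightarrow> real) \<Rightarrow> real \<Rightarrow> real \<Rightarrow> real \<Rightarrow> real \<Rightarrow> real \<Rightarrow>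
   'a tr_run \<Rightarrow> nat \<Rightarrow> nat \<Rightarrow> bool" where
  "bundle_step f C N \<gamma> \<gamma>' \<Gamma> \<theta> M r j k \<longleftrightarrow>
     working_model f (iterate r j) (planes r j k) (model r j k) \<and>
     tr_step f C N \<gamma> \<Gamma> \<theta> M (rho_tilde f r j k \<ge> \<gamma>') r j k \<and>
     (\<not> rho f r j k \<ge> \<gamma> \<longrightarrow>
        update_of_planes f (iterate r j) (trial r j k) (model r j k)
          (planes r j k) (planes r j (Suc k)))"

definition classical_step ::
  "('a::euclidean_space \<Rightarrow> real) \<Rightarrow> 'a set \<Rightarrow> ('a \<Rightarrow> real) \<Rightarrow> real \<Rightarrow> real \<Rightarrow> real \<Rightarrow> real \<Rightarrow>
   'a tr_run \<Rightarrow> nat \<Rightarrow> nat \<Rightarrow> bool" where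
  "classical_step f C N \<gamma> \<Gamma> \<theta> M r j k \<longleftrightarrow>
     (\<exists>g. GDERIV f (iterate r j) :> g \<and>
          planes r j k = {affine_plane f (iterate r j) g} \<and>
          model r j k = affine_plane f (iterate r j) g) \<and>
     tr_step f C N \<gamma> \<Gamma> \<theta> M True r j k"

definition bundle_tr_run ::
  "('a::euclidean_space \<Rightarrow> real) \<Rightarrow> 'a set \<Rightarrow> ('a \<Rightarrow> real) \<Rightarrow> real \<Rightarrow> real \<Rightarrow> real \<Rightarrow> real \<Rightarrow> real \<Rightarrow>
   'a \<Rightarrow> 'a tr_run \<Rightarrow> bool" where
  "bundle_tr_run f C N \<gamma> \<gamma>' \<Gamma> \<theta> M x1 r \<longleftrightarrow>
     iterate r 0 = x1 \<and> memory_radius r 0 > 0 \<and>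
     (\<forall>j k. executed f C \<gamma> r j k \<longrightarrow> bundle_step f C N \<gamma> \<gamma>' \<Gamma> \<theta> M r j k)"

definition classical_tr_run ::
  "('a::euclidean_space \<Rightarrow> real) \<Rightarrow> 'a set \<Rightarrow> ('a \<Rightarrow> real) \<Rightarrow> real \<Rightarrow> real \<Rightarrow> real \<Rightarrow> real \<Rightarrow>
   'a \<Rightarrow> 'a tr_run \<Rightarrow> bool" where
  "classical_tr_run f C N \<gamma> \<Gamma> \<theta> M x1 r \<longleftrightarrow>
     iterate r 0 = x1 \<and> memory_radius r 0 > 0 \<and>
     (\<forall>j k. executed f C \<gamma> r j k \<longrightarrow> classical_step f C N \<gamma> \<Gamma> \<theta> M r j k)"

(* A finite sequence of serious iterates has no accumulation points. *)
definition iterate_accumulation_point ::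
  "('a::euclidean_space \<Rightarrow> real) \<Rightarrow> 'a set \<Rightarrow> real \<Rightarrow> 'a tr_run \<Rightarrow> 'a \<Rightarrow> bool" where
  "iterate_accumulation_point f C \<gamma> r x \<longleftrightarrow>
     (\<exists>s. strict_mono s \<and> (\<forall>i. reached f C \<gamma> r (s i)) \<and> (\<lambda>i. iterate r (s i)) \<longlonglongrightarrow> x)"

definition continuous_distribution_on :: "'a::euclidean_space set \<Rightarrow> 'a measure \<Rightarrow> bool" where
  "continuous_distribution_on C D \<longleftrightarrow>
     prob_space D \<and> sets D = sets borel \<and> emeasure D C = 1 \<and> absolutely_continuous lborel D"

(* The random choice of the trial points: a sequence s of candidates is drawn, and each
   trial step uses one of the candidates not yet passed over.  Candidates which do not
   qualify as trial points have to be skipped, since tr_step constrains the accepted ones;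
   taking the first candidate that qualifies is one possible choice of \<tau>. *)
definition trials_drawn_from ::
  "('a::euclidean_space \<Rightarrow> real) \<Rightarrow> 'a set \<Rightarrow> real \<Rightarrow> (nat \<Rightarrow> 'a) \<Rightarrow> 'a tr_run \<Rightarrow> bool" where
  "trials_drawn_from f C \<gamma> s r \<longleftrightarrow>
     (\<exists>\<tau>. (\<forall>j k. executed f C \<gamma> r j k \<longrightarrow> trial r j k = s (\<tau> j k)) \<and>
          (\<forall>j k j' k'. executed f C \<gamma> r j k \<and> executed f C \<gamma> r j' k' \<and>
             (j < j' \<or> j = j' \<and> k < k') \<longrightarrow> (\<tau> j k :: nat) < \<tau> j' k'))"

end

theory Submission
  imports Defs
begin

text \<open>
  Write \<open>f\<degree>\<close> for the Clarke directional derivative and \<open>\<phi>\<close>-sharp for the standard model.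

  Agreement of the two algorithms.  At a point of strict differentiability \<open>f\<degree>\<close> is linear, so
  the gradient is the only subgradient, the Taylor polynomial is the only cutting plane, and
  every working model equals \<open>\<phi>\<close>-sharp (\<open>working_model_strictly_differentiable\<close>).  The quotient
  \<open>\<rho>\<close>-tilde, which decides about halving, is then \<open>1\<close>: its denominator is positive because a
  noncritical point admits a descent direction towards another point of \<open>C\<close>
  (\<open>descent_direction\<close>, a separation argument).  So the bundle algorithm also halves at every
  null step and is the classical algorithm.  A distribution that charges no Lebesgue null set
  almost surely draws only points of strict differentiability, and every serious iterate after
  the first is a drawn point.

  Convergence.  Suppose the serious iterates
  accumulate at a noncritical point \<open>x\<close>.  As \<open>f\<degree>\<close> is upper semicontinuous
  (\<open>clarke_dd_upper_semicontinuous\<close>), one point of \<open>C\<close> lies in a direction of descent from all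
  feasible points near \<open>x\<close>, and the decrease predicted by the model is at least proportional to
  a small trust-region radius (\<open>model_decrease\<close>).  Each serious step realises a fixed share of the
  prediction, so near \<open>x\<close> the path length is controlled by the decrease of \<open>f\<close>.  The iterates
  therefore never leave a neighbourhood of \<open>x\<close> again, and their radii tend to \<open>0\<close>.  This needs
  infinitely many halvings at small radii near \<open>x\<close>, whereas strictness of the model rules them
  out there (\<open>accumulation_point_critical\<close>).
\<close>


section \<open>The Clarke directional derivative\<close>

definition dd_filter :: "'a::euclidean_space \<Rightarrow> ('a \<times> real) filter" where
  "dd_filter x = nhds x \<times>\<^sub>F at_right 0"

definition dd_quotient :: "('a::euclidean_space \<Rightarrow> real) \<Rightarrow> 'a \<Rightarrow> 'a \<times> real \<Rightarrow> real" where
  "dd_quotient f d = (\<lambda>(y, t). (f (y + t *\<^sub>R d) - f y) / t)"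

lemma clarke_dd_alt:
  "clarke_dd f x d = real_of_ereal (Limsup (dd_filter x) (\<lambda>p. ereal (dd_quotient f d p)))"
  by (simp add: clarke_dd_def dd_filter_def dd_quotient_def case_prod_unfold)

lemma dd_filter_nontrivial: "dd_filter x \<noteq> bot"
  by (simp add: dd_filter_def prod_filter_eq_bot)

lemma eventually_dd_filter_pos: "\<forall>\<^sub>F p in dd_filter x. 0 < snd p"
proof -
  have "filterlim snd (at_right 0) (dd_filter x)"
    by (simp add: dd_filter_def filterlim_snd)
  from eventually_compose_filterlim[OF eventually_at_right_less this] show ?thesis .
qed

text \<open>
  A bound on the quotients near \<open>x\<close> persists when the base point drifts along \<open>d\<close> and the step
  length is rescaled.  The drift gives subadditivity of \<open>f\<degree>\<close> in the direction, the rescaling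
  homogeneity.
\<close>

lemma filterlim_dd_filter_shift:
  "0 < c \<Longrightarrow> filterlim (\<lambda>p. (fst p + snd p *\<^sub>R d, c * snd p)) (dd_filter x) (dd_filter x)"
proof -
  assume c: "0 < c"
  have fst: "filterlim fst (nhds x) (dd_filter x)" and snd: "filterlim snd (at_right 0) (dd_filter x)"
    by (simp_all add: dd_filter_def filterlim_fst filterlim_snd)
  have snd0: "(snd \<longlongrightarrow> (0::real)) (dd_filter x)"
    using snd by (simp add: filterlim_at)
  have "filterlim (\<lambda>p. fst p + snd p *\<^sub>R d) (nhds x) (dd_filter x)"
    using tendsto_add[OF fst tendsto_scaleR[OF snd0 tendsto_const]] by simp
  moreover have "filterlim (\<lambda>p. c * snd p) (at_right 0) (dd_filter x)"
    unfolding filterlim_at using tendsto_mult[OF tendsto_const snd0, of c] eventually_dd_filter_pos[of x] c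
    by (auto elim!: eventually_mono)
  ultimately show ?thesis
    unfolding dd_filter_def[of x] by (rule filterlim_Pair)
qed

text \<open>
  The Lipschitz constant makes \<open>f\<degree>\<close> finite.  That one neighbourhood of \<open>x\<close> serves all
  directions of a bounded set at once lets the direction vary together with the base point in the proof of
  semicontinuity.
\<close>

lemma eventually_lipschitz_quotient:
  fixes f :: "'a::euclidean_space \<Rightarrow> real"
  assumes "locally_lipschitz f"
  obtains L where "0 \<le> L"
    "\<And>B. \<forall>\<^sub>F p in dd_filter x. \<forall>d d'. norm d \<le> B \<and> norm d' \<le> B \<longrightarrow>
       \<bar>f (fst p + snd p *\<^sub>R d) - f (fst p + snd p *\<^sub>R d')\<bar> \<le> L * snd p * norm (d - d')"
proof -
  obtain e L where e: "0 < e" and L: "L-lipschitz_on (ball x e) f"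
    using assms unfolding locally_lipschitz_def by blast
  have "\<forall>\<^sub>F p in dd_filter x. \<forall>d d'. norm d \<le> B \<and> norm d' \<le> B \<longrightarrow>
       \<bar>f (fst p + snd p *\<^sub>R d) - f (fst p + snd p *\<^sub>R d')\<bar> \<le> L * snd p * norm (d - d')" for B
  proof -
    have fst: "filterlim fst (nhds x) (dd_filter x)" and snd: "filterlim snd (at_right 0) (dd_filter x)"
      by (simp_all add: dd_filter_def filterlim_fst filterlim_snd)
    have snd0: "(snd \<longlongrightarrow> (0::real)) (dd_filter x)"
      using snd by (simp add: filterlim_at)
    have "((\<lambda>p. dist x (fst p) + snd p * B) \<longlongrightarrow> dist x x + 0 * B) (dd_filter x)"
      by (intro tendsto_intros fst snd0)
    then have "\<forall>\<^sub>F p in dd_filter x. dist x (fst p) + snd p * B < e"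
      using e by (intro order_tendstoD(2)) auto
    then show ?thesis
      using eventually_dd_filter_pos[of x]
    proof eventually_elim
      case (elim p)
      have in_ball: "fst p + snd p *\<^sub>R d \<in> ball x e" if "norm d \<le> B" for d
      proof -
        have "dist x (fst p + snd p *\<^sub>R d) \<le> dist x (fst p) + snd p * norm d"
          using dist_triangle[of x "fst p + snd p *\<^sub>R d" "fst p"] elim by (simp add: dist_norm)
        also have "\<dots> \<le> dist x (fst p) + snd p * B"
          using that elim by simp
        finally show ?thesis
          using elim by simp
      qed
      show ?case
      proof (intro allI impI)
        fix d d' :: 'a
        assume "norm d \<le> B \<and> norm d' \<le> B"
        then have "dist (f (fst p + snd p *\<^sub>R d)) (f (fst p + snd p *\<^sub>R d'))
            \<le> L * dist (fst p + snd p *\<^sub>R d) (fst p + snd p *\<^sub>R d')"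
          using L in_ball unfolding lipschitz_on_def by blast
        moreover have "dist (fst p + snd p *\<^sub>R d) (fst p + snd p *\<^sub>R d') = snd p * norm (d - d')"
          using elim by (simp add: dist_norm flip: scaleR_diff_right)
        ultimately show "\<bar>f (fst p + snd p *\<^sub>R d) - f (fst p + snd p *\<^sub>R d')\<bar> \<le> L * snd p * norm (d - d')"
          by (simp add: dist_real_def mult.assoc)
      qed
    qed
  qed
  moreover have "0 \<le> L" using L by (simp add: lipschitz_on_def)
  ultimately show ?thesis using that by blast
qed

text \<open>
  The conversion to a real number in the definition of \<open>f\<degree>\<close> loses nothing, because the quotients
  are bounded by \<open>L * norm d\<close>.  Inequalities for \<open>f\<degree>\<close> can thus be proved on the quotients.
\<close>

lemma ereal_clarke_dd:
  assumes "locally_lipschitz f"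
  shows "ereal (clarke_dd f x d) = Limsup (dd_filter x) (\<lambda>p. ereal (dd_quotient f d p))"
proof -
  obtain L where L: "0 \<le> L" and
    ev: "\<And>B. \<forall>\<^sub>F p in dd_filter x. \<forall>d d'. norm d \<le> B \<and> norm d' \<le> B \<longrightarrow>
       \<bar>f (fst p + snd p *\<^sub>R d) - f (fst p + snd p *\<^sub>R d')\<bar> \<le> L * snd p * norm (d - d')"
    using eventually_lipschitz_quotient[OF assms] by blast
  have bound: "\<forall>\<^sub>F p in dd_filter x. \<bar>dd_quotient f d p\<bar> \<le> L * norm d"
    using ev[of "norm d"] eventually_dd_filter_pos[of x]
  proof eventually_elim
    case (elim p)
    then have "\<bar>f (fst p + snd p *\<^sub>R d) - f (fst p)\<bar> \<le> L * snd p * norm d"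
      by (metis diff_zero norm_ge_zero norm_zero order_refl scaleR_zero_right add_0_right)
    then show ?case
      using elim by (simp add: dd_quotient_def case_prod_unfold divide_simps mult_ac)
  qed
  have "Limsup (dd_filter x) (\<lambda>p. ereal (dd_quotient f d p)) \<le> ereal (L * norm d)"
    by (rule Limsup_bounded) (use bound in eventually_elim, auto)
  moreover have "ereal (- (L * norm d)) \<le> Limsup (dd_filter x) (\<lambda>p. ereal (dd_quotient f d p))"
  proof (rule order_trans[OF _ Liminf_le_Limsup[OF dd_filter_nontrivial]])
    show "ereal (- (L * norm d)) \<le> Liminf (dd_filter x) (\<lambda>p. ereal (dd_quotient f d p))"
      by (rule Liminf_bounded) (use bound in eventually_elim, auto)
  qed
  ultimately show ?thesis
    unfolding clarke_dd_alt
    by (cases "Limsup (dd_filter x) (\<lambda>p. ereal (dd_quotient f d p))") auto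
qed

lemma clarke_dd_le:
  assumes "locally_lipschitz f" "\<forall>\<^sub>F p in dd_filter x. dd_quotient f d p \<le> c"
  shows "clarke_dd f x d \<le> c"
proof -
  have "Limsup (dd_filter x) (\<lambda>p. ereal (dd_quotient f d p)) \<le> ereal c"
    by (rule Limsup_bounded) (use assms(2) in simp)
  then show ?thesis by (simp flip: ereal_clarke_dd[OF assms(1)])
qed

lemma eventually_dd_quotient_less:
  assumes "locally_lipschitz f" "clarke_dd f x d < c"
  shows "\<forall>\<^sub>F p in dd_filter x. dd_quotient f d p < c"
proof -
  have "Limsup (dd_filter x) (\<lambda>p. ereal (dd_quotient f d p)) < ereal c"
    using assms by (simp flip: ereal_clarke_dd)
  from Limsup_lessD[OF this] show ?thesis by simp
qed

text \<open>
  A step along \<open>d + d'\<close> is a step along \<open>d\<close> followed by one along \<open>d'\<close> from the shifted base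
  point, and the definition of \<open>f\<degree>\<close> already ranges over all base points near \<open>x\<close>.
\<close>

lemma clarke_dd_subadditive:
  assumes "locally_lipschitz f"
  shows "clarke_dd f x (d + d') \<le> clarke_dd f x d + clarke_dd f x d'"
proof (rule field_le_epsilon)
  fix e :: real
  assume "0 < e"
  then have "\<forall>\<^sub>F p in dd_filter x. dd_quotient f d p < clarke_dd f x d + e / 2"
    and d': "\<forall>\<^sub>F p in dd_filter x. dd_quotient f d' p < clarke_dd f x d' + e / 2"
    by (auto intro!: eventually_dd_quotient_less[OF assms])
  moreover have "\<forall>\<^sub>F p in dd_filter x.
      dd_quotient f d' (fst p + snd p *\<^sub>R d, snd p) < clarke_dd f x d' + e / 2"
    using eventually_compose_filterlim[OF d' filterlim_dd_filter_shift[of 1 d]] by simp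
  ultimately have "\<forall>\<^sub>F p in dd_filter x.
      dd_quotient f (d + d') p \<le> clarke_dd f x d + clarke_dd f x d' + e"
  proof eventually_elim
    case (elim p)
    have "dd_quotient f (d + d') p
        = dd_quotient f d p + dd_quotient f d' (fst p + snd p *\<^sub>R d, snd p)"
      by (simp add: dd_quotient_def case_prod_unfold algebra_simps diff_divide_distrib)
    with elim show ?case by simp
  qed
  then show "clarke_dd f x (d + d') \<le> clarke_dd f x d + clarke_dd f x d' + e"
    by (rule clarke_dd_le[OF assms])
qed

lemma clarke_dd_zero: "clarke_dd f x 0 = 0"
proof -
  have "Limsup (dd_filter x) (\<lambda>p. ereal (dd_quotient f 0 p)) = 0"
    using Limsup_const[OF dd_filter_nontrivial, of x "0::ereal"]
    by (simp add: dd_quotient_def case_prod_unfold zero_ereal_def)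
  then show ?thesis by (simp add: clarke_dd_alt)
qed

lemma clarke_dd_scale_le:
  assumes "locally_lipschitz f" "0 \<le> c"
  shows "clarke_dd f x (c *\<^sub>R d) \<le> c * clarke_dd f x d"
proof (cases "c = 0")
  case True
  then show ?thesis by (simp add: clarke_dd_zero)
next
  case False
  with assms have c: "0 < c" by simp
  show ?thesis
  proof (rule field_le_epsilon)
    fix e :: real
    assume e: "0 < e"
    have "\<forall>\<^sub>F p in dd_filter x. dd_quotient f d p < clarke_dd f x d + e / c"
      using c e by (intro eventually_dd_quotient_less[OF assms(1)]) simp
    then have "\<forall>\<^sub>F p in dd_filter x. dd_quotient f d (fst p, c * snd p) < clarke_dd f x d + e / c"
      using eventually_compose_filterlim[OF _ filterlim_dd_filter_shift[OF c, of 0]] by fastforce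
    then have "\<forall>\<^sub>F p in dd_filter x. dd_quotient f (c *\<^sub>R d) p \<le> c * clarke_dd f x d + e"
    proof eventually_elim
      case (elim p)
      have "dd_quotient f (c *\<^sub>R d) p = c * dd_quotient f d (fst p, c * snd p)"
        using c by (simp add: dd_quotient_def case_prod_unfold mult.commute)
      also have "\<dots> \<le> c * (clarke_dd f x d + e / c)"
        using elim c by simp
      also have "\<dots> = c * clarke_dd f x d + e"
        using c by (simp add: distrib_left)
      finally show ?case .
    qed
    then show "clarke_dd f x (c *\<^sub>R d) \<le> c * clarke_dd f x d + e"
      by (rule clarke_dd_le[OF assms(1)])
  qed
qed

text \<open>
  An upper bound on the difference quotients holds for all base points in an open set, so it
  passes from \<open>x\<close> to its neighbours \<open>x'\<close>; the Lipschitz constant pays for turning the direction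
  from \<open>u - x\<close> to \<open>u - x'\<close>.  Aiming at a fixed point \<open>u\<close> keeps the direction feasible for a convex
  set that contains \<open>u\<close> and \<open>x'\<close>.
\<close>

lemma clarke_dd_upper_semicontinuous:
  fixes f :: "'a::euclidean_space \<Rightarrow> real"
  assumes lip: "locally_lipschitz f" and less: "clarke_dd f x (u - x) < c"
  shows "\<forall>\<^sub>F x' in nhds x. clarke_dd f x' (u - x') < c"
proof -
  define h where "h = c - clarke_dd f x (u - x)"
  have h: "0 < h" using less by (simp add: h_def)
  define B where "B = norm (u - x) + 1"
  obtain L where L: "0 \<le> L" and
    ev: "\<And>B. \<forall>\<^sub>F p in dd_filter x. \<forall>d d'. norm d \<le> B \<and> norm d' \<le> B \<longrightarrow>
       \<bar>f (fst p + snd p *\<^sub>R d) - f (fst p + snd p *\<^sub>R d')\<bar> \<le> L * snd p * norm (d - d')"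
    using eventually_lipschitz_quotient[OF lip] by blast
  have "\<forall>\<^sub>F p in dd_filter x. dd_quotient f (u - x) p < clarke_dd f x (u - x) + h / 3"
    using h by (intro eventually_dd_quotient_less[OF lip]) simp
  with ev[of B] eventually_dd_filter_pos[of x]
  have "\<forall>\<^sub>F p in dd_filter x. \<forall>d. norm d \<le> B \<longrightarrow>
      dd_quotient f d p \<le> clarke_dd f x (u - x) + h / 3 + L * norm (d - (u - x))"
  proof eventually_elim
    case (elim p)
    show ?case
    proof (intro allI impI)
      fix d :: 'a
      assume "norm d \<le> B"
      moreover have "norm (u - x) \<le> B" by (simp add: B_def)
      ultimately have "\<bar>f (fst p + snd p *\<^sub>R d) - f (fst p + snd p *\<^sub>R (u - x))\<bar> \<le> L * snd p * norm (d - (u - x))"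
        using elim(1) by blast
      then have "(f (fst p + snd p *\<^sub>R d) - f (fst p + snd p *\<^sub>R (u - x))) / snd p \<le> L * norm (d - (u - x))"
        using elim(2) by (simp add: divide_simps mult_ac)
      then show "dd_quotient f d p \<le> clarke_dd f x (u - x) + h / 3 + L * norm (d - (u - x))"
        using elim(3) by (simp add: dd_quotient_def case_prod_unfold diff_divide_distrib)
    qed
  qed
  then obtain P Q where P: "eventually P (nhds x)" and Q: "eventually Q (at_right 0)"
    and PQ: "\<And>y t. P y \<Longrightarrow> Q t \<Longrightarrow> \<forall>d. norm d \<le> B \<longrightarrow>
      dd_quotient f d (y, t) \<le> clarke_dd f x (u - x) + h / 3 + L * norm (d - (u - x))"
    unfolding dd_filter_def eventually_prod_filter by auto
  have "((\<lambda>x'. L * norm (x - x')) \<longlongrightarrow> L * norm (x - x)) (nhds x)"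
    by (intro tendsto_intros filterlim_ident)
  then have "\<forall>\<^sub>F x' in nhds x. L * norm (x - x') < h / 3"
    using h by (intro order_tendstoD(2)) auto
  moreover have "((\<lambda>x'. norm (u - x')) \<longlongrightarrow> norm (u - x)) (nhds x)"
    by (intro tendsto_intros filterlim_ident)
  then have "\<forall>\<^sub>F x' in nhds x. norm (u - x') < B"
    by (intro order_tendstoD(2)) (auto simp: B_def)
  moreover have "\<forall>\<^sub>F x' in nhds x. eventually P (nhds x')"
    using P by (simp add: eventually_eventually)
  ultimately show ?thesis
  proof eventually_elim
    case (elim x')
    have "\<forall>\<^sub>F p in dd_filter x'. dd_quotient f (u - x') p \<le> clarke_dd f x (u - x) + h / 3 + L * norm ((u - x') - (u - x))"
      unfolding dd_filter_def eventually_prod_filter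
    proof (intro exI conjI allI impI)
      show "eventually P (nhds x')" "eventually Q (at_right 0)"
        using elim Q by auto
      fix y t
      assume "P y" "Q t"
      moreover have "norm (u - x') \<le> B" using elim by simp
      ultimately show "dd_quotient f (u - x') (y, t)
          \<le> clarke_dd f x (u - x) + h / 3 + L * norm ((u - x') - (u - x))"
        using PQ by blast
    qed
    then have "clarke_dd f x' (u - x') \<le> clarke_dd f x (u - x) + h / 3 + L * norm ((u - x') - (u - x))"
      by (rule clarke_dd_le[OF lip])
    also have "\<dots> \<le> clarke_dd f x (u - x) + 2 / 3 * h"
      using elim by simp
    also have "\<dots> < c"
      using h unfolding h_def by argo
    finally show ?case .
  qed
qed

text \<open>
  Strict differentiability controls \<open>f\<close> along all pairs of points near \<open>x\<close>, in particular along
  the pairs \<open>(y + t d, y)\<close> compared by \<open>f\<degree>\<close>.  So \<open>f\<degree>\<close> is linear, and a linear functional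
  dominates no linear functional but itself.
\<close>

lemma strictly_differentiable_gradient:
  assumes "strictly_differentiable f x"
  shows "\<exists>g. GDERIV f x :> g \<and> (\<forall>d. clarke_dd f x d = g \<bullet> d) \<and> clarke_subdiff f x = {g}"
proof -
  obtain g where g: "((\<lambda>(u, v). (f u - f v - g \<bullet> (u - v)) / norm (u - v)) \<longlongrightarrow> 0) (nhds x \<times>\<^sub>F nhds x)"
    using assms unfolding strictly_differentiable_def by blast
  have dd: "clarke_dd f x d = g \<bullet> d" for d
  proof -
    have fst: "filterlim fst (nhds x) (dd_filter x)"
      by (simp add: dd_filter_def filterlim_fst)
    have shift: "filterlim (\<lambda>p. fst p + snd p *\<^sub>R d) (nhds x) (dd_filter x)"
      using filterlim_compose[OF fst filterlim_dd_filter_shift[of 1 d]] by simp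
    have "((\<lambda>p. norm d * ((\<lambda>(u, v). (f u - f v - g \<bullet> (u - v)) / norm (u - v)) (fst p + snd p *\<^sub>R d, fst p)) + g \<bullet> d)
        \<longlongrightarrow> norm d * 0 + g \<bullet> d) (dd_filter x)"
      by (intro tendsto_intros filterlim_compose[OF g] filterlim_Pair shift fst)
    moreover have "\<forall>\<^sub>F p in dd_filter x. norm d * ((\<lambda>(u, v). (f u - f v - g \<bullet> (u - v)) / norm (u - v)) (fst p + snd p *\<^sub>R d, fst p)) + g \<bullet> d
        = dd_quotient f d p"
      using eventually_dd_filter_pos[of x]
      by eventually_elim (auto simp: dd_quotient_def case_prod_unfold diff_divide_distrib right_diff_distrib)
    ultimately have "(dd_quotient f d \<longlongrightarrow> g \<bullet> d) (dd_filter x)"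
      by (simp add: filterlim_cong[OF refl refl])
    then have "((\<lambda>p. ereal (dd_quotient f d p)) \<longlongrightarrow> ereal (g \<bullet> d)) (dd_filter x)"
      by simp
    from lim_imp_Limsup[OF dd_filter_nontrivial this] show ?thesis
      by (simp add: clarke_dd_alt)
  qed
  have "g' = g" if "\<And>d. g' \<bullet> d \<le> g \<bullet> d" for g'
  proof -
    have "(g' - g) \<bullet> (g' - g) \<le> 0"
      using that[of "g' - g"] by (simp add: inner_diff_left)
    then show ?thesis by (metis inner_ge_zero inner_eq_zero_iff order_antisym right_minus_eq)
  qed
  then have "clarke_subdiff f x = {g}"
    by (auto simp: clarke_subdiff_def dd)
  moreover have "GDERIV f x :> g"
  proof -
    have "((\<lambda>h. (\<lambda>(u, v). (f u - f v - g \<bullet> (u - v)) / norm (u - v)) (x + h, x)) \<longlongrightarrow> 0) (at 0)"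
    proof (intro filterlim_compose[OF g] filterlim_Pair tendsto_const)
      have "((\<lambda>h. x + h) \<longlongrightarrow> x + 0) (at 0)" by (intro tendsto_intros)
      then show "((\<lambda>h. x + h) \<longlongrightarrow> x) (at 0)" by simp
    qed
    then have "((\<lambda>h. (f (x + h) - f x - h \<bullet> g) / norm h) \<longlongrightarrow> 0) (at 0)"
      by (simp add: inner_commute)
    from tendsto_norm_zero[OF this]
    have "((\<lambda>h. norm (f (x + h) - f x - h \<bullet> g) / norm h) \<longlongrightarrow> 0) (at 0)"
      by simp
    then show ?thesis
      by (simp add: gderiv_def has_derivative_at bounded_linear_inner_left)
  qed
  ultimately show ?thesis using dd by blast
qed


section \<open>Descent directions and model decrease\<close>

text \<open>
  If no point of \<open>C\<close> lies in a direction of descent, the convex set of the \<open>(u - x, 0)\<close> with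
  \<open>u \<in> C\<close> is disjoint from the strict epigraph of the sublinear function \<open>f\<degree>\<close>.  A hyperplane
  separating them cannot be vertical, because the epigraph lies above all directions; its slope
  is a subgradient whose negative is normal to \<open>C\<close>.
\<close>

lemma descent_direction:
  fixes f :: "'a::euclidean_space \<Rightarrow> real"
  assumes lip: "locally_lipschitz f" and C: "convex C" and x: "x \<in> C"
    and noncritical: "\<not> critical_point f C x"
  obtains u where "u \<in> C" "clarke_dd f x (u - x) < 0"
proof (rule ccontr)
  assume "\<not> thesis"
  with that have nonneg: "0 \<le> clarke_dd f x (u - x)" if "u \<in> C" for u
    using that by force
  define S :: "('a \<times> real) set" where "S = (\<lambda>u. (u - x, 0)) ` C"
  define T :: "('a \<times> real) set" where "T = {(d, t). clarke_dd f x d < t}"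
  have "convex S"
  proof -
    have "S = (\<lambda>p. (- x, 0) + p) ` ((\<lambda>u. (u, 0)) ` C)"
      by (auto simp: S_def image_image)
    moreover have "convex ((\<lambda>u. (u, 0::real)) ` C)"
      by (intro convex_linear_image C) (auto intro!: linearI)
    ultimately show ?thesis by (simp add: convex_translation)
  qed
  moreover have "convex T"
  proof (rule convexI)
    fix p q :: "'a \<times> real" and a b :: real
    assume pq: "p \<in> T" "q \<in> T" and ab: "0 \<le> a" "0 \<le> b" "a + b = 1"
    have "clarke_dd f x (a *\<^sub>R fst p + b *\<^sub>R fst q) \<le> a * clarke_dd f x (fst p) + b * clarke_dd f x (fst q)"
      using clarke_dd_subadditive[OF lip, of x "a *\<^sub>R fst p" "b *\<^sub>R fst q"]
        clarke_dd_scale_le[OF lip ab(1), of x "fst p"] clarke_dd_scale_le[OF lip ab(2), of x "fst q"]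
      by linarith
    also have "\<dots> < a * snd p + b * snd q"
    proof (cases "a = 0")
      case True
      then show ?thesis using pq ab by (simp add: T_def case_prod_unfold)
    next
      case False
      then have "a * clarke_dd f x (fst p) < a * snd p"
        using pq ab by (simp add: T_def case_prod_unfold)
      moreover have "b * clarke_dd f x (fst q) \<le> b * snd q"
        using pq ab by (intro mult_left_mono) (auto simp: T_def)
      ultimately show ?thesis by simp
    qed
    finally show "a *\<^sub>R p + b *\<^sub>R q \<in> T"
      by (simp add: T_def case_prod_unfold)
  qed
  moreover have "S \<noteq> {}" using x by (auto simp: S_def)
  moreover have "T \<noteq> {}"
  proof -
    have "(0, 1) \<in> T" by (simp add: T_def clarke_dd_zero)
    then show ?thesis by blast
  qed
  moreover have "S \<inter> T = {}" using nonneg by (force simp: S_def T_def)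
  ultimately obtain a b where "a \<noteq> 0" and S: "\<forall>p\<in>S. a \<bullet> p \<le> b" and T: "\<forall>p\<in>T. b \<le> a \<bullet> p"
    using separating_hyperplane_sets[of S T] by auto
  obtain v \<beta> where a: "a = (v, \<beta>)" by (cases a)
  have upper: "v \<bullet> (u - x) \<le> b" if "u \<in> C" for u
    using S that by (auto simp: S_def a)
  have lower: "b \<le> v \<bullet> d + \<beta> * t" if "clarke_dd f x d < t" for d t
    using T that by (auto simp: T_def a)
  have "0 \<le> b" using upper[OF x] by simp
  have "0 \<le> \<beta>"
    using lower[of 0 1] \<open>0 \<le> b\<close> by (simp add: clarke_dd_zero)
  moreover have "\<beta> \<noteq> 0"
  proof
    assume "\<beta> = 0"
    then have "0 \<le> v \<bullet> (- v)"
      using lower[of "- v" "clarke_dd f x (- v) + 1"] \<open>0 \<le> b\<close> by simp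
    then have "v = 0" by (metis inner_minus_right inner_gt_zero_iff neg_0_le_iff_le not_le)
    with \<open>\<beta> = 0\<close> \<open>a \<noteq> 0\<close> a show False by (simp add: zero_prod_def)
  qed
  ultimately have \<beta>: "0 < \<beta>" by simp
  have "b \<le> 0"
  proof (rule field_le_epsilon)
    fix e :: real
    assume "0 < e"
    then show "b \<le> 0 + e"
      using lower[of 0 "e / \<beta>"] \<beta> by (simp add: clarke_dd_zero)
  qed
  define g where "g = - v /\<^sub>R \<beta>"
  have "g \<in> clarke_subdiff f x"
    unfolding clarke_subdiff_def
  proof (intro CollectI allI, rule field_le_epsilon)
    fix d and e :: real
    assume "0 < e"
    then have "0 \<le> v \<bullet> d + \<beta> * (clarke_dd f x d + e)"
      using lower[of d "clarke_dd f x d + e"] \<open>0 \<le> b\<close> by simp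
    then have "- (v \<bullet> d) / \<beta> \<le> clarke_dd f x d + e"
      unfolding pos_divide_le_eq[OF \<beta>] by (simp add: algebra_simps)
    then show "g \<bullet> d \<le> clarke_dd f x d + e"
      by (simp add: g_def divide_inverse mult.commute)
  qed
  moreover have "- g \<in> normal_cone C x"
    using upper \<open>b \<le> 0\<close> \<beta> by (force simp: normal_cone_def g_def intro: mult_nonneg_nonpos)
  ultimately have "critical_point f C x"
    using x unfolding critical_point_def by (intro conjI bexI[of _ g] bexI[of _ "- g"]) auto
  with noncritical show False ..
qed

lemma is_normD:
  assumes "is_norm N"
  shows "N 0 = 0" "N (x + y) \<le> N x + N y" "N (c *\<^sub>R x) = \<bar>c\<bar> * N x"
    "N (x - y) = N (y - x)" "0 \<le> N x" "N x = 0 \<longleftrightarrow> x = 0"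
proof -
  show z: "N 0 = 0" and add: "N (x + y) \<le> N x + N y" and scale: "N (c *\<^sub>R x) = \<bar>c\<bar> * N x"
    and "N x = 0 \<longleftrightarrow> x = 0" for x y c
    using assms by (auto simp: is_norm_def)
  show "N (x - y) = N (y - x)"
    using scale[of "- 1" "y - x"] by simp
  show "0 \<le> N x"
    using z add[of x "- x"] scale[of "- 1" x] by simp
qed

lemma is_norm_equivalent:
  fixes N :: "'a::euclidean_space \<Rightarrow> real"
  assumes N: "is_norm N"
  shows "\<exists>b>0. \<exists>B>0. (\<forall>x. norm x \<le> b * N x) \<and> (\<forall>x. N x \<le> B * norm x)"
proof -
  note [simp] = is_normD(1)[OF N]
  define B where "B = 1 + (\<Sum>i\<in>(Basis::'a set). N i)"
  have B: "0 < B" unfolding B_def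
    using is_normD(5)[OF N] by (simp add: add_pos_nonneg sum_nonneg)
  have upper: "N x \<le> B * norm x" for x
  proof -
    have N_sum: "N (sum g A) \<le> (\<Sum>i\<in>A. N (g i))" if "finite A" for g and A :: "'a set"
      using that
    proof induction
      case (insert i A)
      then show ?case using is_normD(2)[OF N, of "g i" "sum g A"] by simp
    qed simp
    have "N x = N (\<Sum>i\<in>Basis. (x \<bullet> i) *\<^sub>R i)"
      by (simp add: euclidean_representation)
    also have "\<dots> \<le> (\<Sum>i\<in>Basis. N ((x \<bullet> i) *\<^sub>R i))"
      by (rule N_sum) simp
    also have "\<dots> \<le> (\<Sum>i\<in>Basis. norm x * N i)"
      by (intro sum_mono) (simp add: is_normD(3)[OF N] Basis_le_norm is_normD(5)[OF N] mult_right_mono)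
    also have "\<dots> \<le> B * norm x"
      by (simp add: B_def sum_distrib_left algebra_simps)
    finally show ?thesis .
  qed
  have "B-lipschitz_on (sphere 0 1) N"
  proof (rule lipschitz_onI)
    fix x y
    have "N x - N y \<le> N (x - y)" "N y - N x \<le> N (x - y)"
      using is_normD(2)[OF N, of "x - y" y] is_normD(2)[OF N, of "y - x" x] is_normD(4)[OF N, of x y]
      by simp_all
    then show "dist (N x) (N y) \<le> B * dist x y"
      using upper[of "x - y"] by (simp add: dist_norm)
  qed (use B in simp)
  then have "continuous_on (sphere 0 1) N"
    by (rule lipschitz_on_continuous_on)
  moreover have "sphere (0::'a) 1 \<noteq> {}" by simp
  ultimately obtain m where m: "m \<in> sphere 0 1" "\<And>y. y \<in> sphere 0 1 \<Longrightarrow> N m \<le> N y"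
    using continuous_attains_inf[OF compact_sphere] by metis
  then have "0 < N m"
    using is_normD(5,6)[OF N, of m] by (auto simp: less_le)
  have "norm x \<le> 1 / N m * N x" for x
  proof (cases "x = 0")
    case False
    then have "N m \<le> N ((1 / norm x) *\<^sub>R x)" by (intro m) simp
    also have "\<dots> = N x / norm x" by (simp add: is_normD(3)[OF N])
    finally show ?thesis using False \<open>0 < N m\<close> by (simp add: field_simps)
  qed simp
  then show ?thesis
    using B upper \<open>0 < N m\<close> by (intro exI[of _ "1 / N m"] exI[of _ B] conjI) auto
qed

text \<open>
  All slopes are subgradients, and \<open>f\<degree>\<close> dominates each of them in every direction.  The
  decrease estimates see the planes only through this bound.
\<close>

lemma working_model_le_standard_model:
  assumes "working_model f x G \<phi>"
  shows "\<phi> u \<le> standard_model f u x"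
proof -
  obtain m where "m \<in> G" "\<phi> u = m u" using assms unfolding working_model_def by blast
  then obtain g where "g \<in> clarke_subdiff f x" "m = affine_plane f x g"
    using assms unfolding working_model_def cutting_plane_def by blast
  with \<open>\<phi> u = m u\<close> show ?thesis
    by (simp add: clarke_subdiff_def standard_model_def affine_plane_def)
qed

text \<open>
  The comparison point is \<open>x + t (u - x)\<close> with the largest \<open>t \<le> 1\<close> that the radius surely
  permits.  The decrease is therefore proportional to \<open>R\<close> for small \<open>R\<close>, with constants that
  depend on \<open>x\<close> only through \<open>\<eta>\<close> and \<open>K\<close>, hence can be kept fixed while \<open>x\<close> varies locally.
\<close>

lemma model_decrease:
  fixes f :: "'a::euclidean_space \<Rightarrow> real"
  assumes lip: "locally_lipschitz f" and N: "is_norm N" and C: "convex C" and x: "x \<in> C"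
    and u: "u \<in> C" "clarke_dd f x (u - x) \<le> - \<eta>" "0 \<le> \<eta>" "N (u - x) \<le> K" "0 < K" and R: "0 < R"
    and \<phi>: "\<And>v. \<phi> v \<le> standard_model f v x"
    and y: "is_arg_min \<phi> (\<lambda>v. v \<in> C \<and> N (v - x) \<le> R) y"
  shows "\<eta> * min 1 (R / K) \<le> f x - \<phi> y"
proof -
  define t where "t = min 1 (R / K)"
  have t: "0 \<le> t" "t \<le> 1" "t * K \<le> R"
    using u R by (auto simp: t_def min_def field_simps)
  define v where "v = x + t *\<^sub>R (u - x)"
  have "v = (1 - t) *\<^sub>R x + t *\<^sub>R u" by (simp add: v_def algebra_simps)
  then have "v \<in> C" using C x u t by (simp add: convexD)
  moreover have "N (v - x) \<le> R"
  proof -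
    have "N (v - x) = t * N (u - x)" using t by (simp add: v_def is_normD(3)[OF N])
    also have "\<dots> \<le> t * K" using t u by (intro mult_left_mono)
    finally show ?thesis using t by simp
  qed
  ultimately have "\<phi> y \<le> \<phi> v" using y by (auto simp: is_arg_min_def not_less)
  also have "\<dots> \<le> f x + clarke_dd f x (t *\<^sub>R (u - x))"
    using \<phi>[of v] by (simp add: standard_model_def v_def)
  also have "\<dots> \<le> f x + t * clarke_dd f x (u - x)"
    using clarke_dd_scale_le[OF lip t(1)] by simp
  also have "\<dots> \<le> f x + t * (- \<eta>)"
    using u t by (intro add_left_mono mult_left_mono)
  finally show ?thesis by (simp add: t_def mult.commute)
qed

lemma model_decrease_noncritical:
  fixes f :: "'a::euclidean_space \<Rightarrow> real"
  assumes lip: "locally_lipschitz f" and N: "is_norm N" and C: "convex C" and x: "x \<in> C"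
    and noncritical: "\<not> critical_point f C x" and R: "0 < R"
    and \<phi>: "\<And>v. \<phi> v \<le> standard_model f v x"
    and y: "is_arg_min \<phi> (\<lambda>v. v \<in> C \<and> N (v - x) \<le> R) y"
  shows "\<phi> y < f x"
proof -
  obtain u where u: "u \<in> C" "clarke_dd f x (u - x) < 0"
    using descent_direction[OF lip C x noncritical] .
  define \<eta> where "\<eta> = - clarke_dd f x (u - x)"
  have pos: "0 < N (u - x) + 1" using is_normD(5)[OF N, of "u - x"] by simp
  have "\<eta> * min 1 (R / (N (u - x) + 1)) \<le> f x - \<phi> y"
    by (rule model_decrease[OF lip N C x u(1) _ _ _ pos R \<phi> y]) (use u in \<open>auto simp: \<eta>_def\<close>)
  moreover have "0 < \<eta> * min 1 (R / (N (u - x) + 1))"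
  proof (rule mult_pos_pos)
    show "0 < \<eta>" using u by (simp add: \<eta>_def)
    show "0 < min 1 (R / (N (u - x) + 1))" using pos R by simp
  qed
  ultimately show ?thesis by linarith
qed

section \<open>Control flow and invariants of runs\<close>

lemma executed_reached:
  "executed f C \<gamma> r j k \<Longrightarrow> reached f C \<gamma> r j \<and> \<not> critical_point f C (iterate r j)"
  by (induction k) (auto elim: executed.cases)

lemma reached_Suc_serious:
  assumes "reached f C \<gamma> r (Suc j)"
  shows "\<exists>k. executed f C \<gamma> r j k \<and> \<gamma> \<le> rho f r j k"
  using assms by (cases rule: reached.cases) auto

lemma reached_mono:
  assumes "reached f C \<gamma> r j" "i \<le> j"
  shows "reached f C \<gamma> r i"
  using assms(2,1)
  by (induction rule: inc_induct) (blast dest: reached_Suc_serious executed_reached)+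

text \<open>
  The two algorithms differ in their models and in the rule for halving the radius; the
  existential quantifier leaves that rule open, so that the invariants serve both.
\<close>

lemma run_invariants:
  assumes start: "iterate r 0 \<in> C" "0 < memory_radius r 0"
    and step: "\<forall>j k. executed f C \<gamma> r j k \<longrightarrow> (\<exists>h. tr_step f C N \<gamma> \<Gamma> \<theta> M h r j k)"
  shows "reached f C \<gamma> r j \<Longrightarrow> iterate r j \<in> C \<and> 0 < memory_radius r j"
    and "executed f C \<gamma> r j k \<Longrightarrow> 0 < radius r j k"
proof (induction j and j k rule: reached_executed.inducts)
  case start
  show ?case using assms by simp
next
  case (enter j)
  have "radius r j 0 = memory_radius r j"
    using step[rule_format, OF reached_executed.enter[OF enter(1,3)]] by (auto simp: tr_step_def Let_def)
  with enter show ?case by simp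
next
  case (serious j k)
  then show ?case using step[rule_format, OF serious(1)] by (auto simp: tr_step_def Let_def)
next
  case (null j k)
  then show ?case using step[rule_format, OF null(1)] by (auto simp: tr_step_def Let_def split: if_splits)
qed

text \<open>
  If the inner loop has shrunk the radius, then the most recent halving took place at exactly
  twice the present radius.  A small radius is thereby traced to a null step with a comparably
  small radius.
\<close>

lemma radius_halvings:
  assumes step: "\<forall>k. executed f C \<gamma> r j k \<longrightarrow> tr_step f C N \<gamma> \<Gamma> \<theta> M (halve k) r j k"
    and ex: "executed f C \<gamma> r j k"
  shows "radius r j k = memory_radius r j \<or>
    (\<exists>i. executed f C \<gamma> r j i \<and> \<not> \<gamma> \<le> rho f r j i \<and> halve i \<and> radius r j i = 2 * radius r j k)"
  using ex
proof (induction k rule: nat_induct)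
  case 0
  then show ?case using step[rule_format, OF 0] by (simp add: tr_step_def Let_def)
next
  case (Suc k)
  from Suc.prems have ex: "executed f C \<gamma> r j k" and null: "\<not> \<gamma> \<le> rho f r j k"
    by (auto elim: executed.cases)
  have "radius r j (Suc k) = (if halve k then radius r j k / 2 else radius r j k)"
    using step[rule_format, OF ex] null by (simp add: tr_step_def Let_def)
  then show ?case using Suc.IH[OF ex] ex null by (cases "halve k") auto
qed

text \<open>
  The strict inequality is essential: a vanishing denominator would make the quotient \<open>0\<close>
  instead of \<open>1\<close>, and the radius would not be halved.
\<close>

lemma rho_tilde_eq_1:
  assumes "\<And>v. model r j k v = standard_model f v (iterate r j)"
    and "model r j k (trial r j k) < f (iterate r j)"
  shows "rho_tilde f r j k = 1"
  using assms by (simp add: rho_tilde_def)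


text \<open>
  This makes the denominator of both quotients \<open>\<rho>\<close> and \<open>\<rho>\<close>-tilde positive.
\<close>

lemma trial_decrease:
  fixes f :: "'a::euclidean_space \<Rightarrow> real"
  assumes "locally_lipschitz f" "is_norm N" "convex C" "0 < \<theta>"
    and x: "iterate r j \<in> C" "\<not> critical_point f C (iterate r j)" and R: "0 < radius r j k"
    and model: "working_model f (iterate r j) (planes r j k) (model r j k)"
    and step: "tr_step f C N \<gamma> \<Gamma> \<theta> M h r j k"
  shows "model r j k (trial r j k) < f (iterate r j)"
proof -
  have "model r j k (model_min r j k) < f (iterate r j)"
    by (rule model_decrease_noncritical[OF assms(1-3) x R working_model_le_standard_model[OF model]])
       (use step in \<open>simp add: tr_step_def Let_def\<close>)
  then have "0 < \<theta> * (f (iterate r j) - model r j k (model_min r j k))"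
    using \<open>0 < \<theta>\<close> by simp
  then show ?thesis using step by (simp add: tr_step_def Let_def)
qed

section \<open>Runs at points of strict differentiability\<close>

text \<open>
  There is only one subgradient, so all cutting planes, the Taylor polynomial and the standard
  model coincide.
\<close>

lemma strictly_differentiable_planes:
  fixes f :: "'a::euclidean_space \<Rightarrow> real"
  assumes "strictly_differentiable f x"
  shows "\<exists>p. (\<forall>v. standard_model f v x = p v) \<and> (\<forall>z m. cutting_plane f x z m \<longleftrightarrow> m = p) \<and>
    (\<forall>g. GDERIV f x :> g \<longleftrightarrow> affine_plane f x g = p)"
proof -
  obtain g where g: "GDERIV f x :> g" "\<And>d. clarke_dd f x d = g \<bullet> d" "clarke_subdiff f x = {g}"
    using strictly_differentiable_gradient[OF assms] by blast
  have "h = g" if "GDERIV f x :> h" for h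
  proof -
    have "(\<lambda>v. v \<bullet> h) = (\<lambda>v. v \<bullet> g)"
      using that g(1) unfolding gderiv_def by (rule has_derivative_unique)
    then have "\<forall>v. v \<bullet> h = v \<bullet> g" by (simp add: fun_eq_iff)
    then show ?thesis by (simp only: vector_eq_ldot)
  qed
  moreover have "h = g" if "affine_plane f x h = affine_plane f x g" for h
  proof -
    have "h \<bullet> v = g \<bullet> v" for v
      using fun_cong[OF that, of "x + v"] by (simp add: affine_plane_def)
    then have "\<forall>v. h \<bullet> v = g \<bullet> v" by blast
    then show ?thesis by (simp only: vector_eq_rdot)
  qed
  ultimately have "GDERIV f x :> h \<longleftrightarrow> affine_plane f x h = affine_plane f x g" for h
    using g(1) by blast
  moreover have "standard_model f v x = affine_plane f x g v" for v
    by (simp add: standard_model_def affine_plane_def g(2))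
  moreover have "cutting_plane f x z m \<longleftrightarrow> m = affine_plane f x g" for z m
    by (simp add: cutting_plane_def g(2,3))
  ultimately show ?thesis by blast
qed

text \<open>
  Having a single possible plane leaves no freedom in building or updating a working model.
  The last claim is the reason why the classical algorithm, which keeps its plane throughout an
  inner loop, obeys the update rule of the bundle algorithm.
\<close>

lemma working_model_strictly_differentiable:
  fixes f :: "'a::euclidean_space \<Rightarrow> real"
  assumes "strictly_differentiable f x"
  shows "working_model f x G \<phi> \<longleftrightarrow>
    (\<exists>g. GDERIV f x :> g \<and> G = {affine_plane f x g} \<and> \<phi> = affine_plane f x g)"
    and "working_model f x G \<phi> \<Longrightarrow> \<phi> v = standard_model f v x"
    and "working_model f x G \<phi> \<Longrightarrow> working_model f x G' \<phi>' \<Longrightarrow> update_of_planes f x z \<psi> G G'"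
proof -
  obtain p where p: "\<And>v. standard_model f v x = p v" "\<And>z m. cutting_plane f x z m \<longleftrightarrow> m = p"
    "\<And>g. GDERIV f x :> g \<longleftrightarrow> affine_plane f x g = p"
    using strictly_differentiable_planes[OF assms] by blast
  have model: "working_model f x G \<phi> \<longleftrightarrow> G = {p} \<and> \<phi> = p" for G \<phi>
  proof
    assume *: "working_model f x G \<phi>"
    then have "G = {p}" unfolding working_model_def p(2) by blast
    moreover from this * have "\<phi> y = p y" for y unfolding working_model_def by simp
    ultimately show "G = {p} \<and> \<phi> = p" by (simp add: fun_eq_iff)
  next
    assume "G = {p} \<and> \<phi> = p"
    then show "working_model f x G \<phi>" unfolding working_model_def p(2) by simp
  qed
  obtain g where "GDERIV f x :> g"
    using strictly_differentiable_gradient[OF assms] by blast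
  then have "affine_plane f x g = p" by (simp only: p(3))
  then show "working_model f x G \<phi> \<longleftrightarrow>
    (\<exists>g. GDERIV f x :> g \<and> G = {affine_plane f x g} \<and> \<phi> = affine_plane f x g)"
    unfolding model p(3) by auto
  show "working_model f x G \<phi> \<Longrightarrow> \<phi> v = standard_model f v x"
    by (simp add: model p(1))
  show "working_model f x G \<phi> \<Longrightarrow> working_model f x G' \<phi>' \<Longrightarrow> update_of_planes f x z \<psi> G G'"
    by (simp add: model p(2) update_of_planes_def)
qed

text \<open>
  Here the working model equals the standard model, so \<open>\<rho>\<close>-tilde is \<open>1\<close> and the
  bundle algorithm halves after every null step, as the classical one does.
\<close>

lemma halving_at_strictly_differentiable:
  fixes f :: "'a::euclidean_space \<Rightarrow> real"
  assumes f: "locally_lipschitz f" "strictly_differentiable f (iterate r j)"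
    and "is_norm N" "convex C" "0 < \<theta>" "\<gamma>' < 1"
    and "iterate r j \<in> C" "\<not> critical_point f C (iterate r j)" "0 < radius r j k"
    and model: "working_model f (iterate r j) (planes r j k) (model r j k)"
    and step: "tr_step f C N \<gamma> \<Gamma> \<theta> M h r j k"
  shows "\<gamma>' \<le> rho_tilde f r j k"
  using trial_decrease[OF f(1) assms(3-5,7-11)] working_model_strictly_differentiable(2)[OF f(2) model] assms(6)
  by (simp add: rho_tilde_eq_1)

lemma classical_step_iff:
  fixes f :: "'a::euclidean_space \<Rightarrow> real"
  assumes "strictly_differentiable f (iterate r j)"
  shows "classical_step f C N \<gamma> \<Gamma> \<theta> M r j k \<longleftrightarrow>
    working_model f (iterate r j) (planes r j k) (model r j k) \<and> tr_step f C N \<gamma> \<Gamma> \<theta> M True r j k"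
  unfolding classical_step_def working_model_strictly_differentiable(1)[OF assms] ..

text \<open>
  Every serious iterate after the first is a trial point, hence one of the drawn points.  The
  starting point is chosen and not drawn, so nothing follows for \<open>j = 0\<close>.
\<close>

lemma drawn_iterates_strictly_differentiable:
  assumes s: "\<And>i. strictly_differentiable f (s i)" and r: "trials_drawn_from f C \<gamma> s r"
    and step: "\<forall>j k. executed f C \<gamma> r j k \<longrightarrow> (\<exists>h. tr_step f C N \<gamma> \<Gamma> \<theta> M h r j k)"
    and reached: "reached f C \<gamma> r j" "0 < j"
  shows "strictly_differentiable f (iterate r j)"
proof -
  obtain i where j: "j = Suc i" using reached by (cases j) auto
  obtain k where k: "executed f C \<gamma> r i k" "\<gamma> \<le> rho f r i k"
    using reached_Suc_serious reached j by blast
  obtain h where "tr_step f C N \<gamma> \<Gamma> \<theta> M h r i k"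
    using step k(1) by blast
  with k(2) have "iterate r j = trial r i k"
    by (simp add: j tr_step_def Let_def)
  moreover obtain n where "trial r i k = s n"
    using r k unfolding trials_drawn_from_def by metis
  ultimately show ?thesis using s by simp
qed

lemma bundle_run_is_classical:
  fixes f :: "'a::euclidean_space \<Rightarrow> real"
  assumes lip: "locally_lipschitz f" and N: "is_norm N" and C: "convex C" "x1 \<in> C"
    and params: "0 < \<theta>" "\<gamma>' < 1"
    and s: "\<And>i. strictly_differentiable f (s i)" and drawn: "trials_drawn_from f C \<gamma> s r"
    and run: "bundle_tr_run f C N \<gamma> \<gamma>' \<Gamma> \<theta> M x1 r"
    and ex: "executed f C \<gamma> r j k" and "0 < j \<or> strictly_differentiable f x1"
  shows "classical_step f C N \<gamma> \<Gamma> \<theta> M r j k"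
proof -
  have is_bundle: "bundle_step f C N \<gamma> \<gamma>' \<Gamma> \<theta> M r j k" if "executed f C \<gamma> r j k" for j k
    using run that by (simp add: bundle_tr_run_def)
  then have step: "\<forall>j k. executed f C \<gamma> r j k \<longrightarrow> (\<exists>h. tr_step f C N \<gamma> \<Gamma> \<theta> M h r j k)"
    unfolding bundle_step_def by blast
  have start: "iterate r 0 = x1" "iterate r 0 \<in> C" "0 < memory_radius r 0"
    using run C by (auto simp: bundle_tr_run_def)
  note inv = run_invariants[where f = f, OF start(2,3) step]
  have reached: "reached f C \<gamma> r j" "\<not> critical_point f C (iterate r j)"
    using executed_reached[OF ex] by auto
  have sd: "strictly_differentiable f (iterate r j)"
    using drawn_iterates_strictly_differentiable[OF s drawn step reached(1)] assms(11) start(1)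
    by (cases "j = 0") auto
  have model: "working_model f (iterate r j) (planes r j k) (model r j k)"
    and tr: "tr_step f C N \<gamma> \<Gamma> \<theta> M (\<gamma>' \<le> rho_tilde f r j k) r j k"
    using is_bundle[OF ex] by (auto simp: bundle_step_def)
  have "\<gamma>' \<le> rho_tilde f r j k"
    using halving_at_strictly_differentiable[OF lip sd N C(1) params _ reached(2) inv(2)[OF ex] model tr]
      inv(1)[OF reached(1)] by blast
  with tr model show ?thesis by (simp add: classical_step_iff[OF sd])
qed

lemma classical_run_is_bundle:
  fixes f :: "'a::euclidean_space \<Rightarrow> real"
  assumes lip: "locally_lipschitz f" and N: "is_norm N" and C: "convex C" "x1 \<in> C"
    and params: "0 < \<theta>" "\<gamma>' < 1"
    and s: "\<And>i. strictly_differentiable f (s i)" and drawn: "trials_drawn_from f C \<gamma> s r"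
    and run: "classical_tr_run f C N \<gamma> \<Gamma> \<theta> M x1 r" and x1: "strictly_differentiable f x1"
  shows "bundle_tr_run f C N \<gamma> \<gamma>' \<Gamma> \<theta> M x1 r"
proof -
  have classical: "classical_step f C N \<gamma> \<Gamma> \<theta> M r j k" if "executed f C \<gamma> r j k" for j k
    using run that by (simp add: classical_tr_run_def)
  then have step: "\<forall>j k. executed f C \<gamma> r j k \<longrightarrow> (\<exists>h. tr_step f C N \<gamma> \<Gamma> \<theta> M h r j k)"
    unfolding classical_step_def by blast
  have start: "iterate r 0 = x1" "iterate r 0 \<in> C" "0 < memory_radius r 0"
    using run C by (auto simp: classical_tr_run_def)
  note inv = run_invariants[where f = f, OF start(2,3) step]
  have "bundle_step f C N \<gamma> \<gamma>' \<Gamma> \<theta> M r j k" if ex: "executed f C \<gamma> r j k" for j k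
  proof -
    have reached: "reached f C \<gamma> r j" "\<not> critical_point f C (iterate r j)"
      using executed_reached[OF ex] by auto
    have sd: "strictly_differentiable f (iterate r j)"
      using drawn_iterates_strictly_differentiable[OF s drawn step reached(1)] x1 start(1)
      by (cases "j = 0") auto
    have model: "working_model f (iterate r j) (planes r j k) (model r j k)"
      if "executed f C \<gamma> r j k" for k
      using classical[OF that] by (simp add: classical_step_iff[OF sd])
    have tr: "tr_step f C N \<gamma> \<Gamma> \<theta> M True r j k"
      using classical[OF ex] by (simp add: classical_step_def)
    have "\<gamma>' \<le> rho_tilde f r j k"
      using halving_at_strictly_differentiable[OF lip sd N C(1) params _ reached(2) inv(2)[OF ex] model[OF ex] tr]
        inv(1)[OF reached(1)] by blast
    moreover have "update_of_planes f (iterate r j) (trial r j k) (model r j k) (planes r j k) (planes r j (Suc k))"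
      if "\<not> \<gamma> \<le> rho f r j k"
      using working_model_strictly_differentiable(3)[OF sd model[OF ex] model[OF reached_executed.null[OF ex that]]] .
    ultimately show ?thesis using tr model[OF ex] by (simp add: bundle_step_def)
  qed
  then show ?thesis using run by (simp add: bundle_tr_run_def classical_tr_run_def)
qed

text \<open>
  There are only countably many draws, so the exceptional events can be united.  The event does
  not depend on the run; a single null set therefore works for all runs at once.
\<close>

lemma draws_avoid_null_set:
  assumes D: "continuous_distribution_on C D"
    and \<zeta>: "\<And>i::nat. \<zeta> i \<in> borel_measurable P" "\<And>i. distr P borel (\<zeta> i) = D"
    and Q: "AE x in lborel. Q x"
  shows "AE \<omega> in P. \<forall>i. Q (\<zeta> i \<omega>)"
proof -
  have "AE x in D. Q x"
    using D Q by (intro absolutely_continuous_AE[of D lborel]) (auto simp: continuous_distribution_on_def)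
  then have "AE \<omega> in P. Q (\<zeta> i \<omega>)" for i
    using AE_distrD[OF \<zeta>(1)] \<zeta>(2) by metis
  then show ?thesis by (simp add: AE_all_countable)
qed

section \<open>Convergence under a strict model\<close>

text \<open>
  Were there no such \<open>d\<close>, violations at distance \<open>1 / (n + 1)\<close> would form two sequences
  converging to \<open>x\<close> along which the strictness inequality fails.
\<close>

lemma strict_model_uniform:
  assumes strict: "strict_model N f \<phi>" and N: "is_norm N" and e: "0 < e"
  shows "\<exists>d>0. \<forall>y x'. dist x y < d \<longrightarrow> dist x x' < d \<longrightarrow> f y \<le> \<phi> y x' + e * N (y - x')"
proof (rule ccontr)
  assume "\<not> ?thesis"
  then have close_pair: "\<exists>y x'. dist x y < d \<and> dist x x' < d \<and> \<not> f y \<le> \<phi> y x' + e * N (y - x')"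
    if "0 < d" for d
    using that by blast
  define bad where "bad n y x' \<longleftrightarrow> dist x y < inverse (Suc n) \<and> dist x x' < inverse (Suc n) \<and>
      \<not> f y \<le> \<phi> y x' + e * N (y - x')" for n :: nat and y x'
  have "\<forall>n. \<exists>y x'. bad n y x'"
    unfolding bad_def using close_pair by simp
  then obtain y x' where "\<And>n. bad n (y n) (x' n)" by metis
  then have y: "\<And>n::nat. dist x (y n) < inverse (Suc n)"
    and x': "\<And>n::nat. dist x (x' n) < inverse (Suc n)"
    and gt: "\<And>n. \<not> f (y n) \<le> \<phi> (y n) (x' n) + e * N (y n - x' n)"
    by (auto simp: bad_def)
  have lim: "a \<longlonglongrightarrow> x" if "\<And>n::nat. dist x (a n) < inverse (Suc n)" for a
  proof (rule tendsto_dist_iff[THEN iffD2], rule tendsto_sandwich[OF _ _ tendsto_const LIMSEQ_inverse_real_of_nat])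
    have "dist (a n) x \<le> inverse (real (Suc n))" for n
      by (subst dist_commute) (rule less_imp_le[OF that])
    then show "\<forall>\<^sub>F n in sequentially. dist (a n) x \<le> inverse (real (Suc n))"
      by (intro always_eventually allI)
  qed simp
  have "y \<longlonglongrightarrow> x \<and> x' \<longlonglongrightarrow> x"
    using lim[OF y] lim[OF x'] ..
  then obtain \<epsilon> :: "nat \<Rightarrow> real" where \<epsilon>: "\<epsilon> \<longlonglongrightarrow> 0"
    and le: "\<And>n. f (y n) \<le> \<phi> (y n) (x' n) + \<epsilon> n * N (y n - x' n)"
    using strict[unfolded strict_model_def, THEN spec[of _ x], THEN spec[of _ y], THEN spec[of _ x']]
    by blast
  obtain n where "\<epsilon> n < e"
    using eventually_happens'[OF sequentially_bot order_tendstoD(2)[OF \<epsilon> e]] by blast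
  then have "\<epsilon> n * N (y n - x' n) \<le> e * N (y n - x' n)"
    using is_normD(5)[OF N] by (intro mult_right_mono) auto
  with le[of n] gt[of n] show False by simp
qed

lemma locally_lipschitz_isCont:
  fixes f :: "'a::euclidean_space \<Rightarrow> real"
  assumes "locally_lipschitz f"
  shows "isCont f x"
proof -
  obtain e L where "0 < e" "L-lipschitz_on (ball x e) f"
    using assms unfolding locally_lipschitz_def by blast
  then show ?thesis
    using lipschitz_on_continuous_on[of L "ball x e" f] by (simp add: continuous_on_eq_continuous_at)
qed

text \<open>
  Near a noncritical limit the value drops by at least a constant times the radius at each
  serious step, while the step length is at most a constant times the radius.  So the path
  length is bounded by the drop of \<open>f\<close>, which becomes arbitrarily small, and the iterates stay
  trapped near \<open>x\<close> from some index on; their radii are summable and tend to \<open>0\<close>.  But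
  strictness forbids halvings near \<open>x\<close> at small radii: at a halving the standard model confirms
  the predicted decrease while \<open>f\<close> fails to deliver it, so \<open>f\<close> exceeds the standard model at the
  trial point by at least a fixed multiple of the radius.  Without halvings the radii cannot
  decrease, let alone tend to \<open>0\<close>.

  An accumulation point presupposes infinitely many serious iterates, so every inner loop that
  is entered ends with a serious step; \<open>\<kappa> j\<close> below is the index of this step.
\<close>

lemma accumulation_point_critical:
  fixes f :: "'a::euclidean_space \<Rightarrow> real"
  assumes lip: "locally_lipschitz f" and N: "is_norm N" and C: "closed C" "convex C" "x1 \<in> C"
    and params: "0 < \<gamma>" "\<gamma> < \<gamma>'" "0 < \<theta>" "1 \<le> M"
    and strict: "strict_model N f (standard_model f)"
    and run: "bundle_tr_run f C N \<gamma> \<gamma>' \<Gamma> \<theta> M x1 r"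
    and acc: "iterate_accumulation_point f C \<gamma> r x"
  shows "critical_point f C x"
proof (rule ccontr)
  assume noncritical: "\<not> critical_point f C x"
  obtain s where s: "strict_mono s" "\<And>i. reached f C \<gamma> r (s i)" "(\<lambda>i. iterate r (s i)) \<longlonglongrightarrow> x"
    using acc unfolding iterate_accumulation_point_def by blast
  have reached: "reached f C \<gamma> r j" for j
    using reached_mono[OF s(2)[of j]] seq_suble[OF s(1), of j] by blast
  have "\<exists>\<kappa>. \<forall>j. executed f C \<gamma> r j (\<kappa> j) \<and> \<gamma> \<le> rho f r j (\<kappa> j)"
    using reached_Suc_serious[OF reached] by (intro choice) blast
  then obtain \<kappa> where ex: "\<And>j. executed f C \<gamma> r j (\<kappa> j)" and ser: "\<And>j. \<gamma> \<le> rho f r j (\<kappa> j)"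
    by blast
  have model: "working_model f (iterate r j) (planes r j k) (model r j k)"
    and step: "tr_step f C N \<gamma> \<Gamma> \<theta> M (\<gamma>' \<le> rho_tilde f r j k) r j k"
    if "executed f C \<gamma> r j k" for j k
    using run that by (auto simp: bundle_tr_run_def bundle_step_def)
  have start: "iterate r 0 \<in> C" "0 < memory_radius r 0"
    using run C by (auto simp: bundle_tr_run_def)
  have step': "\<forall>j k. executed f C \<gamma> r j k \<longrightarrow> (\<exists>h. tr_step f C N \<gamma> \<Gamma> \<theta> M h r j k)"
    using step by blast
  note inv = run_invariants[where f = f, OF start step']
  have in_C: "iterate r j \<in> C" for j using inv(1)[OF reached] by blast
  define F where "F j = f (iterate r j)" for j
  define R where "R j = radius r j (\<kappa> j)" for j
  have R_pos: "0 < R j" for j using inv(2)[OF ex] by (simp add: R_def)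
  have next_it: "iterate r (Suc j) = trial r j (\<kappa> j)" and next_radius: "R j \<le> memory_radius r (Suc j)" for j
    using step[OF ex[of j]] ser[of j] R_pos[of j] by (auto simp: tr_step_def Let_def R_def)
  have arg_min: "is_arg_min (model r j k) (\<lambda>u. u \<in> C \<and> N (u - iterate r j) \<le> radius r j k) (model_min r j k)"
    and step_length: "N (trial r j k - iterate r j) \<le> M * radius r j k"
    and trial_cond: "\<theta> * (f (iterate r j) - model r j k (model_min r j k))
      \<le> f (iterate r j) - model r j k (trial r j k)"
    if "executed f C \<gamma> r j k" for j k
  proof -
    show min: "is_arg_min (model r j k) (\<lambda>u. u \<in> C \<and> N (u - iterate r j) \<le> radius r j k) (model_min r j k)"
      and "\<theta> * (f (iterate r j) - model r j k (model_min r j k))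
        \<le> f (iterate r j) - model r j k (trial r j k)"
      using step[OF that] by (auto simp: tr_step_def Let_def)
    have "N (trial r j k - iterate r j) \<le> M * N (iterate r j - model_min r j k)"
      using step[OF that] by (auto simp: tr_step_def Let_def)
    also have "\<dots> \<le> M * radius r j k"
      using min params is_normD(4)[OF N, of "model_min r j k"]
      by (intro mult_left_mono) (auto simp: is_arg_min_def)
    finally show "N (trial r j k - iterate r j) \<le> M * radius r j k" .
  qed
  have decrease_pos: "model r j k (trial r j k) < f (iterate r j)" if "executed f C \<gamma> r j k" for j k
    using trial_decrease[OF lip N C(2) params(3) in_C _ inv(2)[OF that] model[OF that] step[OF that]]
      executed_reached[OF that] by blast
  have F_step: "\<gamma> * (f (iterate r j) - model r j (\<kappa> j) (trial r j (\<kappa> j))) \<le> F j - F (Suc j)" for j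
    using ser[of j] decrease_pos[OF ex[of j]]
    by (simp add: rho_def F_def next_it pos_le_divide_eq)
  have "decseq F"
    using F_step decrease_pos[OF ex] params(1)
    by (intro decseq_SucI) (smt (verit) mult_pos_pos)
  have "x \<in> C" by (rule closed_sequentially[OF C(1) _ s(3)]) (rule in_C)
  have F_sub: "(\<lambda>i. F (s i)) \<longlonglongrightarrow> f x"
    unfolding F_def by (rule isCont_tendsto_compose[OF locally_lipschitz_isCont[OF lip] s(3)])
  have "f x \<le> F (s j)" for j
    using \<open>decseq F\<close> s(1) F_sub
    by (intro decseq_ge[of "\<lambda>i. F (s i)"]) (auto simp: decseq_def strict_mono_less_eq)
  then have F_ge: "f x \<le> F j" for j
    using decseqD[OF \<open>decseq F\<close> seq_suble[OF s(1), of j]] by (rule order_trans)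
  obtain b B where b: "0 < b" "\<And>v. norm v \<le> b * N v" and B: "0 < B" "\<And>v. N v \<le> B * norm v"
    using is_norm_equivalent[OF N] by blast

  obtain u where u: "u \<in> C" "clarke_dd f x (u - x) < 0"
    using descent_direction[OF lip C(2) \<open>x \<in> C\<close> noncritical] .
  \<comment> \<open>Half of the descent rate at x is kept, so that it survives on a neighbourhood of x.\<close>
  define \<eta> where "\<eta> = - clarke_dd f x (u - x) / 2"
  have \<eta>: "0 < \<eta>" "clarke_dd f x (u - x) < - \<eta>" using u by (auto simp: \<eta>_def)
  \<comment> \<open>K bounds the N-distance from u to every point within Euclidean distance 1 of x.\<close>
  define K where "K = B * (norm (u - x) + 1)"
  have K: "0 < K" using B by (simp add: K_def add_nonneg_pos)
  define q where "q = \<theta> * \<eta> / K"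
  have q: "0 < q" using params \<eta> K by (simp add: q_def)
  obtain d1 where d1: "0 < d1" "\<And>x'. dist x' x < d1 \<Longrightarrow> clarke_dd f x' (u - x') < - \<eta>"
    using clarke_dd_upper_semicontinuous[OF lip \<eta>(2)] unfolding eventually_nhds_metric by blast
  \<comment> \<open>Strictness is used at this tolerance because a halving step of radius R overshoots the
    standard model by more than (\<gamma>' - \<gamma>) q R, while its length is at most M R.\<close>
  define \<epsilon> where "\<epsilon> = (\<gamma>' - \<gamma>) * q / M"
  have \<epsilon>: "0 < \<epsilon>" using params q by (simp add: \<epsilon>_def)
  obtain d2 where d2: "0 < d2"
    "\<And>y x'. dist x y < d2 \<Longrightarrow> dist x x' < d2 \<Longrightarrow> f y \<le> standard_model f y x' + \<epsilon> * N (y - x')"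
    using strict_model_uniform[OF strict N \<epsilon>, of x] by blast
  \<comment> \<open>Half of d2 is for the iterate, the other half for the step from the iterate to the
    trial point.\<close>
  define e where "e = min 1 (min d1 (d2 / 2))"
  have e: "0 < e" "e \<le> 1" "e \<le> d1" "e \<le> d2 / 2" using d1 d2 by (auto simp: e_def)

  have near: "q * min K (radius r j k) \<le> f (iterate r j) - model r j k (trial r j k)"
    if jk: "executed f C \<gamma> r j k" and close: "dist (iterate r j) x < e" for j k
  proof -
    have "norm (u - iterate r j) \<le> norm (u - x) + 1"
      using norm_triangle_ineq[of "u - x" "x - iterate r j"] close e
      by (simp add: dist_norm norm_minus_commute)
    then have "N (u - iterate r j) \<le> K"
      unfolding K_def using B by (smt (verit) mult_left_mono)
    moreover have "clarke_dd f (iterate r j) (u - iterate r j) \<le> - \<eta>"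
      using d1(2)[of "iterate r j"] close e by simp
    ultimately have "\<eta> * min 1 (radius r j k / K) \<le> f (iterate r j) - model r j k (model_min r j k)"
      by (intro model_decrease[OF lip N C(2) in_C u(1) _ _ _ K inv(2)[OF jk]
            working_model_le_standard_model[OF model[OF jk]] arg_min[OF jk]])
         (use \<eta> in auto)
    then have "\<theta> * (\<eta> * min 1 (radius r j k / K)) \<le> \<theta> * (f (iterate r j) - model r j k (model_min r j k))"
      using params by (intro mult_left_mono) auto
    also note trial_cond[OF jk]
    also have "\<theta> * (\<eta> * min 1 (radius r j k / K)) = q * min K (radius r j k)"
      using K by (simp add: q_def min_def field_simps)
    finally show ?thesis .
  qed

  have no_halving: "\<not> \<gamma>' \<le> rho_tilde f r j k"
    if jk: "executed f C \<gamma> r j k" "\<not> \<gamma> \<le> rho f r j k" and close: "dist (iterate r j) x < e"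
      and small: "radius r j k \<le> K" "b * M * radius r j k < d2 / 2" for j k
  proof
    assume halve: "\<gamma>' \<le> rho_tilde f r j k"
    let ?x = "iterate r j" and ?z = "trial r j k"
    define \<Delta> where "\<Delta> = f ?x - model r j k ?z"
    have \<Delta>: "0 < \<Delta>" using decrease_pos[OF jk(1)] by (simp add: \<Delta>_def)
    have "f ?x - f ?z < \<gamma> * \<Delta>"
      using jk(2) \<Delta> by (simp add: rho_def not_le pos_divide_less_eq flip: \<Delta>_def)
    moreover have "\<gamma>' * \<Delta> \<le> f ?x - standard_model f ?z ?x"
      using halve \<Delta> by (simp add: rho_tilde_def pos_le_divide_eq flip: \<Delta>_def)
    ultimately have "(\<gamma>' - \<gamma>) * \<Delta> < f ?z - standard_model f ?z ?x"
      by (simp add: left_diff_distrib)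
    moreover have "(\<gamma>' - \<gamma>) * (q * radius r j k) \<le> (\<gamma>' - \<gamma>) * \<Delta>"
      using near[OF jk(1) close] small params by (intro mult_left_mono) (auto simp: \<Delta>_def min_absorb2)
    moreover have "f ?z - standard_model f ?z ?x \<le> \<epsilon> * N (?z - ?x)"
    proof -
      have "norm (?z - ?x) \<le> b * (M * radius r j k)"
        using b step_length[OF jk(1)] by (smt (verit) mult_left_mono)
      then have "dist x ?z < d2"
        using dist_triangle[of x ?z ?x] close e small by (simp add: dist_norm norm_minus_commute mult.assoc)
      moreover have "dist x ?x < d2" using close e d2 by (simp add: dist_commute)
      ultimately show ?thesis using d2(2)[of ?z ?x] by simp
    qed
    moreover have "\<epsilon> * N (?z - ?x) \<le> \<epsilon> * (M * radius r j k)"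
      using \<epsilon> step_length[OF jk(1)] by (intro mult_left_mono) auto
    moreover have "\<epsilon> * (M * radius r j k) = (\<gamma>' - \<gamma>) * (q * radius r j k)"
      using params by (simp add: \<epsilon>_def)
    ultimately show False by linarith
  qed

  define c where "c = \<gamma> * q"
  have c: "0 < c" using params q by (simp add: c_def)
  have F_drop: "c * min K (R j) \<le> F j - F (Suc j)" if "dist (iterate r j) x < e" for j
  proof -
    have "\<gamma> * (q * min K (R j)) \<le> \<gamma> * (f (iterate r j) - model r j (\<kappa> j) (trial r j (\<kappa> j)))"
      using near[OF ex that] params by (intro mult_left_mono) (auto simp: R_def)
    with F_step[of j] show ?thesis by (simp add: c_def mult.assoc)
  qed
  define Q where "Q = b * M / c"
  have Q: "0 < Q" using b params c by (simp add: Q_def)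
  obtain J where J: "dist (iterate r J) x < e / 2" "F J - f x < c * K" "Q * (F J - f x) < e / 2"
  proof -
    have "\<forall>\<^sub>F i in sequentially. dist (iterate r (s i)) x < e / 2"
      by (rule tendstoD[OF s(3)]) (use e in simp)
    moreover have "(\<lambda>i. F (s i) - f x) \<longlonglongrightarrow> 0"
      using F_sub by (simp add: LIM_zero)
    then have "\<forall>\<^sub>F i in sequentially. F (s i) - f x < min (c * K) (e / 2 / Q)"
      using c K Q e by (intro order_tendstoD(2)) auto
    ultimately have "\<forall>\<^sub>F i in sequentially. dist (iterate r (s i)) x < e / 2 \<and>
        F (s i) - f x < min (c * K) (e / 2 / Q)"
      by eventually_elim simp
    then obtain i where i: "dist (iterate r (s i)) x < e / 2" "F (s i) - f x < min (c * K) (e / 2 / Q)"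
      by (auto dest: eventually_happens'[OF sequentially_bot])
    then have "(F (s i) - f x) * Q < e / 2"
      using Q by (simp add: pos_less_divide_eq)
    with i that[of "s i"] show ?thesis by (simp add: mult.commute)
  qed
  \<comment> \<open>A radius of K or more would make the value drop by c K, which exceeds what is left after J.\<close>
  have R_le: "c * R j \<le> F j - F (Suc j)" if "J \<le> j" "dist (iterate r j) x < e" for j
  proof -
    have "c * min K (R j) < c * K"
      using F_drop[OF that(2)] F_ge[of "Suc j"] decseqD[OF \<open>decseq F\<close> that(1)] J(2) by linarith
    then have "min K (R j) = R j" using c by (auto simp: min_def)
    with F_drop[OF that(2)] show ?thesis by simp
  qed
  \<comment> \<open>Telescoping: by R_le the distance covered in step j is at most Q times the drop in that
    step.\<close>
  have trapped: "dist (iterate r j) x < e / 2 + Q * (F J - F j) \<and> dist (iterate r j) x < e" if "J \<le> j" for j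
    using that
  proof (induction rule: dec_induct)
    case base
    then show ?case using J e by simp
  next
    case (step j)
    have "norm (iterate r (Suc j) - iterate r j) \<le> b * (M * R j)"
      using b step_length[OF ex[of j]] unfolding next_it R_def by (smt (verit) mult_left_mono)
    also have "\<dots> = Q * (c * R j)" using c by (simp add: Q_def)
    also have "\<dots> \<le> Q * (F j - F (Suc j))"
      using R_le step Q by (intro mult_left_mono) auto
    finally have "dist (iterate r (Suc j)) x < e / 2 + Q * (F J - F j) + Q * (F j - F (Suc j))"
      using step dist_triangle[of "iterate r (Suc j)" x "iterate r j"] by (simp add: dist_norm)
    then have *: "dist (iterate r (Suc j)) x < e / 2 + Q * (F J - F (Suc j))"
      by (simp add: algebra_simps)
    moreover have "Q * (F J - F (Suc j)) \<le> Q * (F J - f x)"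
      using F_ge[of "Suc j"] Q by (intro mult_left_mono) auto
    ultimately show ?case using J(3) by linarith
  qed

  have "R \<longlonglongrightarrow> 0"
  proof -
    obtain L where L: "F \<longlonglongrightarrow> L" using decseq_convergent[OF \<open>decseq F\<close>] F_ge by blast
    have "(\<lambda>j. (F j - F (Suc j)) / c) \<longlonglongrightarrow> (L - L) / c"
      by (intro tendsto_intros L LIMSEQ_Suc) (use c in simp)
    then have lim: "(\<lambda>j. (F j - F (Suc j)) / c) \<longlonglongrightarrow> 0" by simp
    show ?thesis
    proof (rule tendsto_sandwich[OF _ _ tendsto_const lim])
      show "\<forall>\<^sub>F j in sequentially. 0 \<le> R j" using R_pos by (simp add: less_imp_le)
      show "\<forall>\<^sub>F j in sequentially. R j \<le> (F j - F (Suc j)) / c"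
        using eventually_ge_at_top[of J]
        by eventually_elim (use R_le trapped c in \<open>simp add: pos_le_divide_eq mult.commute\<close>)
    qed
  qed
  \<comment> \<open>The null step that caused a halving has radius 2 R j, which accounts for a factor 2 in both
    bounds.\<close>
  define \<delta> where "\<delta> = min (K / 2) (d2 / (4 * b * M))"
  have "0 < \<delta>" using K d2 b params by (simp add: \<delta>_def)
  then have "\<forall>\<^sub>F j in sequentially. R j < \<delta>"
    using order_tendstoD(2)[OF \<open>R \<longlonglongrightarrow> 0\<close>] by blast
  then obtain J' where J': "\<And>j. J' \<le> j \<Longrightarrow> R j < \<delta>"
    unfolding eventually_sequentially by blast
  have grow: "R j \<le> R (Suc j)" if "max J J' \<le> j" for j
  proof -
    have False if i: "executed f C \<gamma> r (Suc j) i" "\<not> \<gamma> \<le> rho f r (Suc j) i" "\<gamma>' \<le> rho_tilde f r (Suc j) i"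
      "radius r (Suc j) i = 2 * R (Suc j)" for i
    proof -
      have "R (Suc j) < K / 2" "R (Suc j) < d2 / (4 * b * M)"
        using J'[of "Suc j"] \<open>max J J' \<le> j\<close> by (auto simp: \<delta>_def)
      moreover from this(2) have "R (Suc j) * (4 * b * M) < d2"
        using b params by (simp add: pos_less_divide_eq)
      ultimately show False
        using no_halving[OF i(1,2)] i(3,4) trapped[of "Suc j"] \<open>max J J' \<le> j\<close> by (simp add: mult_ac)
    qed
    moreover have "\<forall>k. executed f C \<gamma> r (Suc j) k \<longrightarrow>
        tr_step f C N \<gamma> \<Gamma> \<theta> M (\<gamma>' \<le> rho_tilde f r (Suc j) k) r (Suc j) k"
      using step by blast
    note radius_halvings[OF this ex]
    ultimately have "R (Suc j) = memory_radius r (Suc j)"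
      unfolding R_def by blast
    with next_radius[of j] show ?thesis by simp
  qed
  have "R (max J J') \<le> R j" if "max J J' \<le> j" for j
    using that by (induction rule: dec_induct) (blast intro: order_refl order_trans grow)+
  then have "\<forall>\<^sub>F j in sequentially. R (max J J') \<le> R j"
    unfolding eventually_sequentially by blast
  then have "R (max J J') \<le> 0"
    by (rule tendsto_lowerbound[OF \<open>R \<longlonglongrightarrow> 0\<close>]) simp
  with R_pos[of "max J J'"] show False by simp
qed

theorem proposition2:
  fixes C :: "(real ^ 'n) set"
    and f :: "real ^ 'n \<Rightarrow> real"
    and N :: "real ^ 'n \<Rightarrow> real"
    and x1 :: "real ^ 'n"
    and \<gamma> \<gamma>' \<Gamma> \<theta> M :: real
    and P :: "'w measure"
    and D :: "(real ^ 'n) measure"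
    and \<zeta> :: "nat \<Rightarrow> 'w \<Rightarrow> real ^ 'n"
  assumes norm: "is_norm N"
    and params: "0 < \<gamma>" "\<gamma> < \<gamma>'" "\<gamma>' < 1" "\<gamma> < \<Gamma>" "\<Gamma> \<le> 1" "0 < \<theta>" "\<theta> < 1" "1 \<le> M"
    and C: "closed C" "convex C"
    and f: "essentially_smooth f"
    and x1: "x1 \<in> C" "bounded {x \<in> C. f x \<le> f x1}"
    and distribution: "continuous_distribution_on C D"
    and draws: "prob_space P"
      "\<And>i. \<zeta> i \<in> borel_measurable P"
      "\<And>i. distr P borel (\<zeta> i) = D"
      "prob_space.indep_vars P (\<lambda>_. borel) \<zeta> UNIV"
  shows
    "(AE \<omega> in P. \<forall>r. trials_drawn_from f C \<gamma> (\<lambda>i. \<zeta> i \<omega>) r \<longrightarrow>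
        (strictly_differentiable f x1 \<longrightarrow>
           (bundle_tr_run f C N \<gamma> \<gamma>' \<Gamma> \<theta> M x1 r \<longleftrightarrow> classical_tr_run f C N \<gamma> \<Gamma> \<theta> M x1 r)) \<and>
        (bundle_tr_run f C N \<gamma> \<gamma>' \<Gamma> \<theta> M x1 r \<longrightarrow>
           (\<forall>j k. 0 < j \<and> executed f C \<gamma> r j k \<longrightarrow> classical_step f C N \<gamma> \<Gamma> \<theta> M r j k))) \<and>
     (strict_model N f (standard_model f) \<longrightarrow>
        (\<forall>\<omega> \<in> space P. \<forall>r.
           trials_drawn_from f C \<gamma> (\<lambda>i. \<zeta> i \<omega>) r \<and> bundle_tr_run f C N \<gamma> \<gamma>' \<Gamma> \<theta> M x1 r \<longrightarrow>
           (\<forall>x. iterate_accumulation_point f C \<gamma> r x \<longrightarrow> critical_point f C x)))"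
proof (intro conjI impI)
  have lip: "locally_lipschitz f" using f by (simp add: essentially_smooth_def)
  have "AE \<omega> in P. \<forall>i. strictly_differentiable f (\<zeta> i \<omega>)"
    by (rule draws_avoid_null_set[OF distribution draws(2,3)])
       (use f in \<open>simp add: essentially_smooth_def\<close>)
  then show "AE \<omega> in P. \<forall>r. trials_drawn_from f C \<gamma> (\<lambda>i. \<zeta> i \<omega>) r \<longrightarrow>
        (strictly_differentiable f x1 \<longrightarrow>
           (bundle_tr_run f C N \<gamma> \<gamma>' \<Gamma> \<theta> M x1 r \<longleftrightarrow> classical_tr_run f C N \<gamma> \<Gamma> \<theta> M x1 r)) \<and>
        (bundle_tr_run f C N \<gamma> \<gamma>' \<Gamma> \<theta> M x1 r \<longrightarrow>
           (\<forall>j k. 0 < j \<and> executed f C \<gamma> r j k \<longrightarrow> classical_step f C N \<gamma> \<Gamma> \<theta> M r j k))"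
  proof eventually_elim
    case (elim \<omega>)
    note is_bundle = bundle_run_is_classical[OF lip norm C(2) x1(1) params(6,3) spec[OF elim]]
    note is_classical = classical_run_is_bundle[OF lip norm C(2) x1(1) params(6,3) spec[OF elim]]
    show ?case
    proof (intro allI impI conjI iffI)
      fix r
      assume drawn: "trials_drawn_from f C \<gamma> (\<lambda>i. \<zeta> i \<omega>) r"
      {
        assume "strictly_differentiable f x1" and run: "bundle_tr_run f C N \<gamma> \<gamma>' \<Gamma> \<theta> M x1 r"
        with is_bundle[OF drawn run] show "classical_tr_run f C N \<gamma> \<Gamma> \<theta> M x1 r"
          by (auto simp: classical_tr_run_def bundle_tr_run_def)
      next
        assume "strictly_differentiable f x1" "classical_tr_run f C N \<gamma> \<Gamma> \<theta> M x1 r"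
        then show "bundle_tr_run f C N \<gamma> \<gamma>' \<Gamma> \<theta> M x1 r"
          using is_classical[OF drawn] by blast
      next
        fix j k
        assume "bundle_tr_run f C N \<gamma> \<gamma>' \<Gamma> \<theta> M x1 r" "0 < j \<and> executed f C \<gamma> r j k"
        then show "classical_step f C N \<gamma> \<Gamma> \<theta> M r j k"
          using is_bundle[OF drawn] by blast
      }
    qed
  qed
  assume "strict_model N f (standard_model f)"
  then show "\<forall>\<omega> \<in> space P. \<forall>r.
      trials_drawn_from f C \<gamma> (\<lambda>i. \<zeta> i \<omega>) r \<and> bundle_tr_run f C N \<gamma> \<gamma>' \<Gamma> \<theta> M x1 r \<longrightarrow>
      (\<forall>x. iterate_accumulation_point f C \<gamma> r x \<longrightarrow> critical_point f C x)"
    using accumulation_point_critical[OF lip norm C x1(1) params(1,2,6,8)] by blast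
qed

end
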